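(* Fix a constant $c>0$ and a sequence of finite $d$-regular graphs $(G_d)_{d\in\mathbb{N}}$; let $p=c/d$ and let $G_{d,p}$ be the random spanning subgraph of $G_d$ obtained by retaining each edge independently with probability $p$. For $r\in\mathbb{N}$, let $\mu_{r,d}$ be the random (empirical) measure on finite rooted graphs given, conditionally on $G_{d,p}$, by $$\mu_{r,d}(H,u)=\frac{1}{|V(G_{d,p})|}\,\big|\{v\in V(G_{d,p}) : B^r_{G_{d,p}}[v]\simeq (H,u)\}\big|,$$ and let $\mu_r$ be the distribution of $B^r_{\mathrm{GW}_c}[o]$, where $\mathrm{GW}_c$ is a Galton–Watson tree with root $o$ and offspring distribution $\mathrm{Po}(c)$. Then for every $r\in\mathbb{N}$, $$\mathbb{P}\Big(d_{\mathrm{TV}}(\mu_{r,d},\mu_r)\ge \exp\big(-\tfrac14(\log d)^{1/(2r)}\big)\Big)=o(d^{-1/3})\quad\text{as } d\to\infty.$$ In particular, $(\mu_{r,d})_{d\in\mathbb{N}}$ converges locally in probability to $\mu_r$; that is, for every $r$ and every finite rooted graph $(\bar H,\bar u)$, $\mu_{r,d}(\bar H,\bar u)\to \mu_r(\bar H,\bar u)$ in probability as $d\to\infty$.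
   Context: For a graph $H$, a vertex $v$ and an integer $r\ge0$, $B^r_H[v]$ denotes the subgraph of $H$ induced by the vertices at graph distance at most $r$ from $v$, viewed as a graph rooted at $v$; $\simeq$ denotes isomorphism of rooted graphs. Logarithms are natural. For probability measures $\mu_1,\mu_2$ on a countable set $\Omega$ (here the isomorphism classes of finite rooted graphs), $d_{\mathrm{TV}}(\mu_1,\mu_2)=\frac12\sum_{\omega\in\Omega}|\mu_1(\omega)-\mu_2(\omega)|$. *)

theory Defs
  imports "HOL-Probability.Probability" "HOL-Library.Landau_Symbols"
begin

definition simple_graph :: "'v set \<Rightarrow> 'v set set \<Rightarrow> bool" where
  "simple_graph V E \<longleftrightarrow> finite V \<and>
     (\<forall>e\<in>E. \<exists>x y. x \<noteq> y \<and> x \<in> V \<and> y \<in> V \<and> e = {x, y})"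

definition regular :: "nat \<Rightarrow> 'v set \<Rightarrow> 'v set set \<Rightarrow> bool" where
  "regular d V E \<longleftrightarrow> (\<forall>v\<in>V. card {e\<in>E. v \<in> e} = d)"

fun dist_le :: "'v set set \<Rightarrow> nat \<Rightarrow> 'v \<Rightarrow> 'v \<Rightarrow> bool" where
  "dist_le E 0 v w \<longleftrightarrow> v = w"
| "dist_le E (Suc k) v w \<longleftrightarrow> dist_le E k v w \<or> (\<exists>u. dist_le E k v u \<and> {u, w} \<in> E)"

type_synonym 'v rgraph = "'v set \<times> 'v set set \<times> 'v"

definition ball :: "'v set \<Rightarrow> 'v set set \<Rightarrow> nat \<Rightarrow> 'v \<Rightarrow> 'v rgraph" where
  "ball V E r v = (let B = {w\<in>V. dist_le E r v w} in (B, {e\<in>E. e \<subseteq> B}, v))"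

definition rg_iso :: "'v rgraph \<Rightarrow> 'w rgraph \<Rightarrow> bool" where
  "rg_iso G H \<longleftrightarrow> (case G of (V1, E1, o1) \<Rightarrow> case H of (V2, E2, o2) \<Rightarrow>
     (\<exists>f. bij_betw f V1 V2 \<and> f o1 = o2 \<and>
          (\<forall>x\<in>V1. \<forall>y\<in>V1. {x, y} \<in> E1 \<longleftrightarrow> {f x, f y} \<in> E2)))"

text \<open>Universal carrier for finite rooted graphs: vertices are lists of naturals
  (every finite rooted graph is isomorphic to one of these).\<close>
definition finite_rgraphs :: "nat list rgraph set" where
  "finite_rgraphs = {(V, E, rt). simple_graph V E \<and> rt \<in> V}"

definition iso_classes :: "nat list rgraph set set" where
  "iso_classes = finite_rgraphs // {(G, H). G \<in> finite_rgraphs \<and> H \<in> finite_rgraphs \<and> rg_iso G H}"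

definition emp_measure :: "'v set \<Rightarrow> 'v set set \<Rightarrow> nat \<Rightarrow> nat list rgraph set \<Rightarrow> real" where
  "emp_measure V E r C = real (card {v\<in>V. \<exists>H\<in>C. rg_iso (ball V E r v) H}) / real (card V)"

definition random_subgraph :: "'v set set \<Rightarrow> real \<Rightarrow> 'v set set pmf" where
  "random_subgraph E p = map_pmf (\<lambda>f. {e\<in>E. f e}) (Pi_pmf E False (\<lambda>_. bernoulli_pmf p))"

text \<open>Vertex set of the first r generations of a Poisson(c) Galton--Watson tree;
  vertex [i1,...,ik] is the child i_k of [i1,...,i_(k-1)] (parent = butlast), root [].\<close>
fun gw_verts :: "real \<Rightarrow> nat \<Rightarrow> nat list set pmf" where
  "gw_verts c 0 = return_pmf {[]}"
| "gw_verts c (Suc r) =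
     bind_pmf (poisson_pmf c) (\<lambda>k.
     map_pmf (\<lambda>S. insert [] (\<Union>i<k. (\<lambda>p. i # p) ` S i)) (Pi_pmf {..<k} {} (\<lambda>_. gw_verts c r)))"

definition tree_of :: "nat list set \<Rightarrow> nat list rgraph" where
  "tree_of S = (S, {{p, p @ [i]} | p i. p @ [i] \<in> S}, [])"

definition gw_ball :: "real \<Rightarrow> nat \<Rightarrow> nat list rgraph pmf" where
  "gw_ball c r = map_pmf tree_of (gw_verts c r)"

definition dTV :: "(nat list rgraph set \<Rightarrow> real) \<Rightarrow> (nat list rgraph set \<Rightarrow> real) \<Rightarrow> real" where
  "dTV \<mu>1 \<mu>2 = (1/2) * infsum (\<lambda>C. \<bar>\<mu>1 C - \<mu>2 C\<bar>) iso_classes"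

end

theory Submission
  imports Defs "HOL-Combinatorics.Multiset_Permutations" "HOL-Real_Asymp.Real_Asymp"
begin

text \<open>
  Second moment method, indexed by plane trees rather than by isomorphism classes. For a plane tree
  \<open>S\<close> of height at most \<open>r\<close>, count the maps \<open>f\<close> from \<open>S\<close> onto the \<open>r\<close>-ball of \<open>v\<close> in the random
  subgraph and divide by the number of sibling orderings of \<open>S\<close>; summed over all \<open>S\<close> these weights are
  at most 1. For a fixed injective \<open>f\<close>, being such a map is a cylinder event: \<open>card S - 1\<close> edges are open and
  \<open>d i + O((card S)\<^sup>2)\<close> edges are closed, where \<open>i\<close> is the number of vertices of depth below \<open>r\<close>. As
  there are about \<open>d ^ (card S - 1)\<close> choices of \<open>f\<close>, the expected weight is the Galton--Watson probability of
  \<open>S\<close> up to a factor \<open>1 + O((card S)\<^sup>2 / d)\<close>. Pairs of maps with disjoint images factorise up to the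
  same error, and overlapping pairs contribute only \<open>O(1/d)\<close> because \<open>v\<close> has boundedly many vertices
  within distance \<open>2 r\<close> on average. So the averaged weight has an \<open>L\<^sup>2\<close> error of order
  \<open>card S / sqrt d\<close>.

  The total variation distance is at most the sum of these errors over plane trees of degree at most
  \<open>k\<close>, plus a multiple of the mass that the Galton--Watson law puts elsewhere: a deficit on the
  remaining classes is at most their mass, and an excess is compensated by a deficit elsewhere.
\<close>

section \<open>Plane trees and the Galton--Watson law\<close>

text \<open>Isomorphism classes would bring in automorphism groups. Ordered trees avoid them:
  \<open>orderings S\<close> is the product of the factorials in the Poisson weights, so the
  expected weight, about \<open>d ^ (n - 1) * (c / d) ^ (n - 1) * exp (- c) ^ i / orderings
  S\<close> with \<open>n = card S\<close>, is the Galton--Watson weight as it stands. The graphs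
  may have short cycles, so the image of a tree can have chords. Those are required to be closed,
  and as there are at most \<open>n\<^sup>2\<close> of them, this only costs a factor
  \<open>1 - O(n\<^sup>2 / d)\<close>. The weights bound the empirical measure from below only.
  Hence balls with cycles or large degrees, which get no weight from the truncated trees, never have
  to be analysed. As for the exponents, Cauchy--Schwarz and Markov leave
  \<open>d powr (- 1/2)\<close> per tree, up to the tree size and the threshold. With
  \<open>x = ln d powr (1 / (2 * r))\<close> one has \<open>x ^ r = sqrt (ln d)\<close>, so the
  number of trees, their sizes and the threshold \<open>exp (- x / 4)\<close> together lose only a
  factor that is subpolynomial in \<open>d\<close>. Any exponent below 1/2 can be reached in this
  way, in particular 1/3.\<close>

definition plane_tree :: "nat \<Rightarrow> nat list set \<Rightarrow> bool" where
  "plane_tree r S \<longleftrightarrow> finite S \<and> [] \<in> S \<and> (\<forall>q i. q @ [i] \<in> S \<longrightarrow> q \<in> S) \<and>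
     (\<forall>q i j. q @ [i] \<in> S \<longrightarrow> j < i \<longrightarrow> q @ [j] \<in> S) \<and> (\<forall>q\<in>S. length q \<le> r)"

definition nchild :: "nat list set \<Rightarrow> nat list \<Rightarrow> nat" where
  "nchild S q = card {i. q @ [i] \<in> S}"

definition plane_trees :: "nat \<Rightarrow> nat \<Rightarrow> nat list set set" where
  "plane_trees r k = {S. plane_tree r S \<and> (\<forall>q. nchild S q \<le> k)}"

text \<open>This is the set in the second equation of \<open>gw_verts\<close>, so one step of the
  Galton--Watson recursion reads \<open>map_pmf (graft k)\<close>.\<close>

definition graft :: "nat \<Rightarrow> (nat \<Rightarrow> nat list set) \<Rightarrow> nat list set" where
  "graft k S = insert [] (\<Union>i<k. (\<lambda>p. i # p) ` S i)"

definition branch :: "nat \<Rightarrow> nat list set \<Rightarrow> nat list set" where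
  "branch i T = {p. i # p \<in> T}"

text \<open>Vertices of depth \<open>r\<close> contribute no factor, because
  \<open>gw_verts c r\<close> does not reveal their offspring.\<close>

definition gw_weight :: "real \<Rightarrow> nat \<Rightarrow> nat list set \<Rightarrow> real" where
  "gw_weight c r S = (\<Prod>q | q \<in> S \<and> length q < r. pmf (poisson_pmf c) (nchild S q))"

lemma plane_treeD:
  assumes "plane_tree r S"
  shows "finite S" "[] \<in> S" "\<And>q i. q @ [i] \<in> S \<Longrightarrow> q \<in> S"
    "\<And>q i j. q @ [i] \<in> S \<Longrightarrow> j < i \<Longrightarrow> q @ [j] \<in> S" "\<And>q. q \<in> S \<Longrightarrow> length q \<le> r"
  using assms unfolding plane_tree_def by blast+

lemma finite_initial_segment:
  fixes A :: "nat set"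
  assumes "finite A" "\<And>i j. i \<in> A \<Longrightarrow> j < i \<Longrightarrow> j \<in> A"
  shows "A = {..<card A}"
proof (cases "A = {}")
  case False
  have "Max A \<in> A" using assms(1) False by (rule Max_in)
  then have "A = {..Max A}"
    using assms(2)[of "Max A"] Max_ge[OF assms(1)] by (auto simp: order.order_iff_strict)
  then have "A = {..<Suc (Max A)}" by (simp add: lessThan_Suc_atMost)
  then show ?thesis by (metis card_lessThan)
qed auto

lemma children_eq:
  assumes "plane_tree r S" shows "{i. q @ [i] \<in> S} = {..<nchild S q}"
proof -
  have "finite {i. q @ [i] \<in> S}"
    using finite_vimageI[OF plane_treeD(1)[OF assms], of "\<lambda>i. q @ [i]"]
    by (simp add: inj_def vimage_def)
  then show ?thesis
    unfolding nchild_def by (rule finite_initial_segment) (use plane_treeD(4)[OF assms] in auto)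
qed

lemma less_nchild_iff: "plane_tree r S \<Longrightarrow> i < nchild S q \<longleftrightarrow> q @ [i] \<in> S"
  using children_eq[of r S q] by auto

lemma nchild_full_depth: "plane_tree r S \<Longrightarrow> r \<le> length q \<Longrightarrow> nchild S q = 0"
  using less_nchild_iff[of r S 0 q] plane_treeD(5)[of r S "q @ [0]"] by fastforce

lemma snoc_in_graft_iff:
  "q @ [i] \<in> graft k S \<longleftrightarrow> (case q of [] \<Rightarrow> i < k \<and> [] \<in> S i | a # p \<Rightarrow> a < k \<and> p @ [i] \<in> S a)"
  unfolding graft_def by (cases q) auto

lemma Cons_in_graft_iff: "a # p \<in> graft k S \<longleftrightarrow> a < k \<and> p \<in> S a"
  unfolding graft_def by auto

lemma branch_graft: "i < k \<Longrightarrow> branch i (graft k S) = S i"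
  unfolding branch_def by (auto simp: Cons_in_graft_iff)

lemma nchild_graft_Nil: "\<forall>i<k. [] \<in> S i \<Longrightarrow> nchild (graft k S) [] = k"
proof -
  assume "\<forall>i<k. [] \<in> S i"
  then have "{i. [] @ [i] \<in> graft k S} = {..<k}"
    unfolding snoc_in_graft_iff by auto
  then show ?thesis unfolding nchild_def by simp
qed

lemma nchild_graft_Cons: "nchild (graft k S) (a # p) = (if a < k then nchild (S a) p else 0)"
  unfolding nchild_def snoc_in_graft_iff by simp

lemma plane_tree_graft:
  assumes "\<And>i. i < k \<Longrightarrow> plane_tree r (S i)"
  shows "plane_tree (Suc r) (graft k S)"
  unfolding plane_tree_def
proof (intro conjI allI impI ballI)
  show "finite (graft k S)" unfolding graft_def using plane_treeD(1)[OF assms] by auto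
  show "[] \<in> graft k S" unfolding graft_def by auto
  show "q \<in> graft k S" if "q @ [i] \<in> graft k S" for q i
    using that plane_treeD(3)[OF assms]
    by (cases q) (auto simp: snoc_in_graft_iff Cons_in_graft_iff \<open>[] \<in> graft k S\<close>)
  show "q @ [j] \<in> graft k S" if "q @ [i] \<in> graft k S" "j < i" for q i j
    using that plane_treeD(2,4)[OF assms] unfolding snoc_in_graft_iff
    by (cases q) auto
  show "length q \<le> Suc r" if "q \<in> graft k S" for q
    using that plane_treeD(5)[OF assms] by (cases q) (auto simp: Cons_in_graft_iff)
qed

lemma nchild_branch: "nchild (branch i T) q = nchild T (i # q)"
  unfolding nchild_def branch_def by simp

lemma plane_tree_branch:
  assumes T: "plane_tree (Suc r) T" and i: "[i] \<in> T"
  shows "plane_tree r (branch i T)"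
  unfolding plane_tree_def
proof (intro conjI allI impI ballI)
  show "finite (branch i T)"
    using finite_vimageI[OF plane_treeD(1)[OF T], of "\<lambda>p. i # p"]
    by (simp add: inj_def vimage_def branch_def)
  show "[] \<in> branch i T" using i by (simp add: branch_def)
  show "q \<in> branch i T" if "q @ [j] \<in> branch i T" for q j
    using that plane_treeD(3)[OF T, of "i # q"] by (simp add: branch_def)
  show "q @ [l] \<in> branch i T" if "q @ [j] \<in> branch i T" "l < j" for q j l
    using that plane_treeD(4)[OF T, of "i # q"] by (simp add: branch_def)
  show "length q \<le> r" if "q \<in> branch i T" for q
    using that plane_treeD(5)[OF T, of "i # q"] by (simp add: branch_def)
qed

lemma plane_tree_hd: 
  assumes "plane_tree r T" "i # p \<in> T"
  shows "[i] \<in> T"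
  using assms(2)
proof (induction p rule: rev_induct)
  case (snoc x xs)
  then show ?case using plane_treeD(3)[OF assms(1), of "i # xs" x] by simp
qed simp

lemma graft_branch:
  assumes T: "plane_tree r T"
  shows "graft (nchild T []) (\<lambda>i. branch i T) = T"
proof (rule set_eqI)
  fix q
  show "q \<in> graft (nchild T []) (\<lambda>i. branch i T) \<longleftrightarrow> q \<in> T"
    using plane_tree_hd[OF T] less_nchild_iff[OF T, of _ "[]"] plane_treeD(2)[OF T]
    by (cases q) (auto simp: Cons_in_graft_iff branch_def graft_def)
qed

lemma plane_tree_0_iff: "plane_tree 0 S \<longleftrightarrow> S = {[]}"
  unfolding plane_tree_def by auto

lemma gw_weight_Suc:
  assumes T: "plane_tree (Suc r) T"
  shows "gw_weight c (Suc r) T = pmf (poisson_pmf c) (nchild T []) *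
           (\<Prod>i<nchild T []. gw_weight c r (branch i T))"
proof -
  let ?k = "nchild T []"
  have fin: "finite (branch i T)" if "i < ?k" for i
    using that plane_treeD(1)[OF plane_tree_branch[OF T]] less_nchild_iff[OF T, of _ "[]"] by simp
  have eq: "{q \<in> T. length q < Suc r} =
      insert [] ((\<lambda>(i, p). i # p) ` (SIGMA i:{..<?k}. {p \<in> branch i T. length p < r}))"
    (is "?L = insert [] ?R")
  proof (rule set_eqI)
    fix q
    show "q \<in> ?L \<longleftrightarrow> q \<in> insert [] ?R"
      using plane_tree_hd[OF T] less_nchild_iff[OF T, of _ "[]"] plane_treeD(2)[OF T]
      by (cases q) (auto simp: branch_def image_iff)
  qed
  have "gw_weight c (Suc r) T = (\<Prod>q\<in>insert [] ?R. pmf (poisson_pmf c) (nchild T q))"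
    unfolding gw_weight_def eq[symmetric] by simp
  also have "\<dots> = pmf (poisson_pmf c) ?k * (\<Prod>q\<in>?R. pmf (poisson_pmf c) (nchild T q))"
    using fin by (subst prod.insert) (auto intro!: finite_imageI finite_SigmaI)
  also have "(\<Prod>q\<in>?R. pmf (poisson_pmf c) (nchild T q)) =
     (\<Prod>(i, p)\<in>(SIGMA i:{..<?k}. {p \<in> branch i T. length p < r}). pmf (poisson_pmf c) (nchild T (i # p)))"
    by (subst prod.reindex) (auto simp: inj_on_def case_prod_beta)
  also have "\<dots> = (\<Prod>i<?k. \<Prod>p\<in>{p \<in> branch i T. length p < r}. pmf (poisson_pmf c) (nchild T (i # p)))"
    using fin by (subst prod.Sigma) auto
  finally show ?thesis unfolding gw_weight_def nchild_branch .
qed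

lemma Nil_in_gw_verts: "S \<in> set_pmf (gw_verts c r) \<Longrightarrow> [] \<in> S"
  by (cases r) auto

text \<open>Grafting can be undone: \<open>k\<close> is the number of children of the root and
  \<open>S i\<close> is the branch at \<open>i\<close>. So only one offspring number and one family
  of subtrees produce \<open>T\<close>, and the resulting recursion is that of
  \<open>gw_weight_Suc\<close>.\<close>

lemma pmf_gw_verts_le:
  assumes "plane_tree r T"
  shows "pmf (gw_verts c r) T \<le> gw_weight c r T"
  using assms
proof (induction r arbitrary: T)
  case 0
  then show ?case by (simp add: pmf_le_1 gw_weight_def)
next
  case (Suc r)
  let ?k = "nchild T []"
  let ?P = "\<lambda>k. Pi_pmf {..<k} {} (\<lambda>_. gw_verts c r)"
  let ?B = "\<Prod>i<?k. gw_weight c r (branch i T)"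
  have B: "(\<Prod>i<?k. pmf (gw_verts c r) (branch i T)) \<le> ?B"
    using Suc.IH[OF plane_tree_branch[OF Suc.prems]] less_nchild_iff[OF Suc.prems, of _ "[]"]
    by (intro prod_mono) auto
  have *: "pmf (map_pmf (graft k) (?P k)) T \<le> indicator {?k} k * ?B" for k
  proof -
    \<comment> \<open>The value \<open>{}\<close> outside \<open>{..<k}\<close> is the default of
      \<open>Pi_pmf\<close>. Restricting to the support below ensures \<open>[] \<in> S i\<close>:
      an empty subtree would make a child disappear, and \<open>k\<close> could no longer be read
      off from \<open>T\<close>.\<close>
    let ?f = "\<lambda>i. if i < k then branch i T else {}"
    have sub: "{S. graft k S = T} \<inter> set_pmf (?P k) \<subseteq> (if k = ?k then {?f} else {})"
    proof
      fix S assume "S \<in> {S. graft k S = T} \<inter> set_pmf (?P k)"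
      then have S: "graft k S = T" "\<And>i. i < k \<Longrightarrow> [] \<in> S i" "\<And>i. \<not> i < k \<Longrightarrow> S i = {}"
        using Nil_in_gw_verts by (auto simp: set_Pi_pmf PiE_dflt_def)
      have "k = ?k" using nchild_graft_Nil[of k S] S by auto
      moreover have "S = ?f"
      proof
        show "S i = ?f i" for i using branch_graft[of i k S] S by auto
      qed
      ultimately show "S \<in> (if k = ?k then {?f} else {})" by simp
    qed
    have "pmf (map_pmf (graft k) (?P k)) T = measure_pmf.prob (?P k) {S. graft k S = T}"
      by (simp add: pmf_map vimage_def)
    also have "\<dots> = measure_pmf.prob (?P k) ({S. graft k S = T} \<inter> set_pmf (?P k))"
      by (simp add: measure_Int_set_pmf)
    also have "\<dots> \<le> measure_pmf.prob (?P k) (if k = ?k then {?f} else {})"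
      using sub by (intro measure_pmf.finite_measure_mono) auto
    also have "\<dots> = (if k = ?k then pmf (?P k) ?f else 0)"
      by (simp add: measure_pmf_single)
    also have "\<dots> \<le> indicator {?k} k * ?B"
      using B by (auto simp: pmf_Pi)
    finally show ?thesis .
  qed
  have "pmf (gw_verts c (Suc r)) T = (\<integral>k. pmf (map_pmf (graft k) (?P k)) T \<partial>poisson_pmf c)"
    by (simp add: pmf_bind graft_def[abs_def])
  also have "\<dots> \<le> (\<integral>k. indicator {?k} k * ?B \<partial>poisson_pmf c)"
    using * by (intro integral_mono measure_pmf.integrable_const_bound[where B=1]
        integrable_mult_left integrable_measure_pmf_finite)
      (auto simp: pmf_le_1 intro!: integrable_real_indicator simp: less_top[symmetric])
  also have "\<dots> = pmf (poisson_pmf c) ?k * ?B"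
    by (simp add: measure_pmf_single)
  finally show ?case using gw_weight_Suc[OF Suc.prems] by simp
qed

section \<open>Number and size of the plane trees of bounded degree\<close>

lemma plane_trees_0: "plane_trees 0 k = {{[]}}"
  unfolding plane_trees_def plane_tree_0_iff nchild_def by auto

lemma plane_trees_branch:
  assumes "T \<in> plane_trees (Suc r) k" "i < nchild T []"
  shows "branch i T \<in> plane_trees r k"
  using assms plane_tree_branch[of r T i] less_nchild_iff[of "Suc r" T i "[]"]
  by (auto simp: plane_trees_def nchild_branch)

lemma graft_in_plane_trees:
  assumes "j \<le> k" "\<And>i. i < j \<Longrightarrow> S i \<in> plane_trees r k"
  shows "graft j S \<in> plane_trees (Suc r) k"
proof -
  have "nchild (graft j S) q \<le> k" for q
  proof (cases q)
    case Nil
    have "\<forall>i<j. [] \<in> S i" using assms(2) plane_treeD(2) by (auto simp: plane_trees_def)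
    then show ?thesis using assms(1) Nil nchild_graft_Nil by simp
  next
    case (Cons a p)
    then show ?thesis using assms(2)[of a] by (auto simp: plane_trees_def nchild_graft_Cons)
  qed
  then show ?thesis
    using plane_tree_graft[of j r S] assms(2) by (auto simp: plane_trees_def)
qed

text \<open>A tree is a root with \<open>j \<le> k\<close> branches, so the numbers
  \<open>N r\<close> of trees satisfy \<open>N (Suc r) \<le> (1 + k) * B ^ k\<close> whenever
  \<open>1 \<le> B\<close> and \<open>N r \<le> B\<close>. The double exponential reproduces itself
  because \<open>1 + (1 + k) ^ r * k \<le> (1 + k) ^ Suc r\<close>.\<close>

lemma finite_plane_trees: "finite (plane_trees r k)"
  and card_plane_trees: "card (plane_trees r k) \<le> (1 + k) ^ ((1 + k) ^ r)"
proof (induction r)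
  case (Suc r)
  let ?X = "SIGMA j:{..k}. PiE {..<j} (\<lambda>_. plane_trees r k)"
  let ?B = "(1 + k) ^ ((1 + k) ^ r)"
  have sub: "plane_trees (Suc r) k \<subseteq> (\<lambda>(j, S). graft j S) ` ?X"
  proof
    fix T assume T: "T \<in> plane_trees (Suc r) k"
    let ?S = "restrict (\<lambda>i. branch i T) {..<nchild T []}"
    have "T = graft (nchild T []) (\<lambda>i. branch i T)"
      using T graft_branch[of "Suc r" T] by (simp add: plane_trees_def)
    also have "\<dots> = graft (nchild T []) ?S" unfolding graft_def by simp
    finally have "T = (\<lambda>(j, S). graft j S) (nchild T [], ?S)" by simp
    moreover have "(nchild T [], ?S) \<in> ?X"
      using T plane_trees_branch[OF T] by (auto simp: plane_trees_def)
    ultimately show "T \<in> (\<lambda>(j, S). graft j S) ` ?X" by blast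
  qed
  have fin: "finite ?X" using Suc.IH(1) by (intro finite_SigmaI finite_PiE) auto
  show "finite (plane_trees (Suc r) k)" by (rule finite_surj[OF fin sub])
  have "card (plane_trees (Suc r) k) \<le> card ?X"
    by (rule surj_card_le[OF fin sub])
  also have "\<dots> = (\<Sum>j\<le>k. card (plane_trees r k) ^ j)"
    using Suc.IH(1) by (subst card_SigmaI) (auto simp: finite_PiE card_PiE)
  also have "\<dots> \<le> (\<Sum>j\<le>k. ?B ^ k)"
  proof (rule sum_mono)
    fix j assume "j \<in> {..k}"
    have "card (plane_trees r k) ^ j \<le> ?B ^ j" using Suc.IH(2) by (rule power_mono) simp
    also have "\<dots> \<le> ?B ^ k" using \<open>j \<in> {..k}\<close> by (intro power_increasing) auto
    finally show "card (plane_trees r k) ^ j \<le> ?B ^ k" .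
  qed
  also have "\<dots> = (1 + k) ^ (1 + (1 + k) ^ r * k)"
    by (simp add: power_add power_mult)
  also have "\<dots> \<le> (1 + k) ^ ((1 + k) ^ Suc r)"
    by (intro power_increasing) (auto simp: algebra_simps)
  finally show "card (plane_trees (Suc r) k) \<le> (1 + k) ^ ((1 + k) ^ Suc r)" .
qed (auto simp: plane_trees_0)

lemma card_le_plane_trees:
  assumes "S \<in> plane_trees r k"
  shows "card S \<le> (1 + k) ^ r"
  using assms
proof (induction r arbitrary: S)
  case (Suc r)
  let ?n = "nchild S []"
  have n: "?n \<le> k" using Suc.prems by (simp add: plane_trees_def)
  have S: "S = insert [] (\<Union>i<?n. (\<lambda>p. i # p) ` branch i S)"
    using graft_branch[of "Suc r" S] Suc.prems by (simp add: plane_trees_def graft_def)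
  have "card S \<le> Suc (card (\<Union>i<?n. (\<lambda>p. i # p) ` branch i S))"
    by (subst S) (rule card_insert_le_m1, auto)
  also have "card (\<Union>i<?n. (\<lambda>p. i # p) ` branch i S) \<le> (\<Sum>i<?n. card ((\<lambda>p. i # p) ` branch i S))"
    by (rule card_UN_le) simp
  also have "\<dots> = (\<Sum>i<?n. card (branch i S))"
    by (intro sum.cong refl card_image) (auto simp: inj_on_def)
  also have "\<dots> \<le> (\<Sum>i<?n. (1 + k) ^ r)"
    using Suc.IH plane_trees_branch[OF Suc.prems] by (intro sum_mono) auto
  also have "\<dots> \<le> k * (1 + k) ^ r" using n by simp
  also have "Suc (k * (1 + k) ^ r) \<le> (1 + k) ^ Suc r" by simp
  finally show ?case by simp
qed (auto simp: plane_trees_0)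

section \<open>Galton--Watson mass outside the bounded-degree trees\<close>

lemma measure_bind_pmf_expectation:
  "measure_pmf.prob (bind_pmf p f) A = measure_pmf.expectation p (\<lambda>x. measure_pmf.prob (f x) A)"
  unfolding measure_pmf_bind
  by (subst measure_pmf.measure_bind[where N="count_space UNIV"])
     (auto simp: space_subprob_algebra measure_pmf.subprob_space_axioms intro: prob_space_imp_subprob_space)

lemma measure_bind_pmf_le:
  assumes "\<And>x. x \<in> set_pmf p \<Longrightarrow> measure_pmf.prob (f x) A \<le> g x" "integrable (measure_pmf p) g"
  shows "measure_pmf.prob (bind_pmf p f) A \<le> measure_pmf.expectation p g"
  unfolding measure_bind_pmf_expectation
  using assms measure_pmf.integrable_const_bound[where M=p and B=1 and f="\<lambda>x. measure_pmf.prob (f x) A"]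
  by (intro integral_mono_AE) (auto simp: AE_measure_pmf_iff)

text \<open>Union bound over the root and its branches: with \<open>a\<close> the Poisson tail, the
  failure probabilities satisfy \<open>t (Suc r) \<le> a + k * t r\<close> and
  \<open>t 0 = 0\<close>, and \<open>a * (1 + k) ^ r\<close> dominates this recursion.\<close>

lemma gw_verts_tail:
  "measure_pmf.prob (gw_verts c r) (- plane_trees r k) \<le>
     measure_pmf.prob (poisson_pmf c) {k<..} * real (1 + k) ^ r"
proof (induction r)
  case 0
  then show ?case by (simp add: plane_trees_0 indicator_def)
next
  case (Suc r)
  let ?P = "\<lambda>k. Pi_pmf {..<k} {} (\<lambda>_. gw_verts c r)"
  let ?t = "measure_pmf.prob (gw_verts c r) (- plane_trees r k)"
  let ?a = "measure_pmf.prob (poisson_pmf c) {k<..}"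
  have *: "measure_pmf.prob (map_pmf (graft j) (?P j)) (- plane_trees (Suc r) k) \<le>
      indicator {k<..} j + real k * ?t" for j
  proof (cases "j \<le> k")
    case True
    have "measure_pmf.prob (map_pmf (graft j) (?P j)) (- plane_trees (Suc r) k) \<le>
       measure_pmf.prob (?P j) (\<Union>i<j. {S. S i \<in> - plane_trees r k})"
      unfolding measure_map_pmf
      using graft_in_plane_trees[OF True] by (intro measure_pmf.finite_measure_mono) auto
    also have "\<dots> \<le> (\<Sum>i<j. measure_pmf.prob (?P j) {S. S i \<in> - plane_trees r k})"
      by (rule measure_pmf.finite_measure_subadditive_finite) auto
    also have "\<dots> = (\<Sum>i<j. ?t)"
    proof (rule sum.cong[OF refl])
      fix i assume i: "i \<in> {..<j}"
      have "?t = measure_pmf.prob (map_pmf (\<lambda>S. S i) (?P j)) (- plane_trees r k)"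
        using i by (subst Pi_pmf_component) auto
      then show "measure_pmf.prob (?P j) {S. S i \<in> - plane_trees r k} = ?t"
        by (simp add: measure_map_pmf vimage_def)
    qed
    also have "\<dots> \<le> real k * ?t" using True by (simp add: mult_right_mono)
    finally show ?thesis using True by simp
  next
    case False
    then have "measure_pmf.prob (map_pmf (graft j) (?P j)) (- plane_trees (Suc r) k) \<le> indicator {k<..} j"
      by simp
    then show ?thesis by (rule order_trans) simp
  qed
  have "measure_pmf.prob (gw_verts c (Suc r)) (- plane_trees (Suc r) k) \<le>
     measure_pmf.expectation (poisson_pmf c) (\<lambda>j. indicator {k<..} j + real k * ?t)"
    unfolding gw_verts.simps graft_def[symmetric, abs_def] using *
    by (intro measure_bind_pmf_le) (auto intro!: Bochner_Integration.integrable_add integrable_real_indicator simp: less_top[symmetric])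
  also have "\<dots> = ?a + real k * ?t"
    by (subst Bochner_Integration.integral_add) (auto intro!: integrable_real_indicator simp: less_top[symmetric])
  also have "\<dots> \<le> ?a * real (1 + k) ^ r + real k * (?a * real (1 + k) ^ r)"
    using Suc.IH by (intro add_mono mult_left_mono) (auto simp: mult_le_cancel_left1)
  also have "\<dots> = ?a * real (1 + k) ^ Suc r" by (simp add: algebra_simps)
  finally show ?case .
qed

text \<open>Exponential tilting: on \<open>{k<..}\<close> the factor \<open>exp (j - k)\<close> is
  at least 1, and \<open>exp j\<close> turns the Poisson weights for \<open>c\<close> into those for
  \<open>exp 1 * c\<close>, up to the constant \<open>exp ((exp 1 - 1) * c)\<close>.\<close>

lemma poisson_tail:
  assumes "c > 0"
  shows "measure_pmf.prob (poisson_pmf c) {k<..} \<le> exp ((exp 1 - 1) * c) * exp (- real k)"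
proof -
  let ?C = "exp ((exp 1 - 1) * c) * exp (- real k)"
  have "measure_pmf.prob (poisson_pmf c) {k<..} = infsetsum (pmf (poisson_pmf c)) {k<..}"
    by (rule measure_pmf_conv_infsetsum)
  also have "\<dots> \<le> infsetsum (\<lambda>j. ?C * pmf (poisson_pmf (exp 1 * c)) j) {k<..}"
  proof (rule infsetsum_mono)
    fix j assume "j \<in> {k<..}"
    then have "exp (real k) \<le> exp 1 ^ j"
      by (simp add: exp_of_nat_mult[symmetric])
    then have "1 \<le> exp (- real k) * exp 1 ^ j"
      by (simp add: exp_minus field_simps)
    then have "c ^ j / fact j * exp (- c) * 1 \<le> c ^ j / fact j * exp (- c) * (exp (- real k) * exp 1 ^ j)"
      using assms by (intro mult_left_mono) auto
    also have "\<dots> = ?C * pmf (poisson_pmf (exp 1 * c)) j"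
      using assms by (simp add: power_mult_distrib exp_minus exp_diff field_simps flip: exp_add)
    finally show "pmf (poisson_pmf c) j \<le> ?C * pmf (poisson_pmf (exp 1 * c)) j"
      using assms by simp
  qed (auto intro: pmf_abs_summable abs_summable_on_cmult_right)
  also have "\<dots> = ?C * measure_pmf.prob (poisson_pmf (exp 1 * c)) {k<..}"
    by (simp add: infsetsum_cmult_right pmf_abs_summable measure_pmf_conv_infsetsum)
  also have "\<dots> \<le> ?C * 1" by (intro mult_left_mono) auto
  finally show ?thesis by simp
qed

section \<open>Balls as images of plane trees\<close>

text \<open>Extensionality makes this a finite set in which a map is determined by its values on
  \<open>S\<close>. Images need not be induced: chords in \<open>E\<close> are allowed here and
  handled by \<open>closed_edges\<close>.\<close>

definition embeddings :: "'v set set \<Rightarrow> 'v \<Rightarrow> nat list set \<Rightarrow> (nat list \<Rightarrow> 'v) set" where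
  "embeddings E v S = {f \<in> extensional S. f [] = v \<and> inj_on f S \<and>
     (\<forall>q i. q @ [i] \<in> S \<longrightarrow> {f q, f (q @ [i])} \<in> E)}"

definition open_edges :: "(nat list \<Rightarrow> 'v) \<Rightarrow> nat list set \<Rightarrow> 'v set set" where
  "open_edges f S = {{f q, f (q @ [i])} | q i. q @ [i] \<in> S}"

text \<open>The two clauses reflect what a ball of radius \<open>r\<close> sees: all edges at a
  vertex of depth below \<open>r\<close>, but at depth \<open>r\<close> only those joining two
  vertices of the ball, since the ball is an induced subgraph. Edges leaving the ball from depth
  \<open>r\<close> stay unconstrained.\<close>

definition closed_edges :: "'v set set \<Rightarrow> nat \<Rightarrow> (nat list \<Rightarrow> 'v) \<Rightarrow> nat list set \<Rightarrow> 'v set set" where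
  "closed_edges E r f S =
     {e \<in> E - open_edges f S. (\<exists>q\<in>S. length q < r \<and> f q \<in> e) \<or> e \<subseteq> f ` S}"

definition ball_maps :: "'v set set \<Rightarrow> nat \<Rightarrow> 'v \<Rightarrow> nat list set \<Rightarrow> 'v set set \<Rightarrow> (nat list \<Rightarrow> 'v) set" where
  "ball_maps E r v S E' =
     {f \<in> embeddings E v S. open_edges f S \<subseteq> E' \<and> closed_edges E r f S \<inter> E' = {}}"

definition orderings :: "nat list set \<Rightarrow> nat" where
  "orderings S = (\<Prod>q\<in>S. fact (nchild S q))"

lemma simple_graphD:
  assumes "simple_graph V E"
  shows "finite V" "\<And>x y. {x, y} \<in> E \<Longrightarrow> x \<noteq> y" "\<And>x y. {x, y} \<in> E \<Longrightarrow> x \<in> V"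
    "\<And>x y. {x, y} \<in> E \<Longrightarrow> y \<in> V" "E \<subseteq> Pow V" "finite E"
proof -
  show V: "finite V" using assms by (simp add: simple_graph_def)
  show "x \<noteq> y" if "{x, y} \<in> E" for x y
    using assms that unfolding simple_graph_def by (metis doubleton_eq_iff)
  show E: "E \<subseteq> Pow V" using assms unfolding simple_graph_def by auto
  show "finite E" using E V finite_subset by blast
  show "x \<in> V" "y \<in> V" if "{x, y} \<in> E" for x y using E that by auto
qed

lemma simple_graph_edgeE:
  assumes "simple_graph V E" "e \<in> E"
  obtains x y where "e = {x, y}" "x \<noteq> y" "x \<in> V" "y \<in> V"
  using assms unfolding simple_graph_def by metis

lemma embeddingsD:
  assumes "f \<in> embeddings E v S"
  shows "f [] = v" "inj_on f S" "\<And>q i. q @ [i] \<in> S \<Longrightarrow> {f q, f (q @ [i])} \<in> E" "f \<in> extensional S"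
  using assms unfolding embeddings_def by auto

lemma embeddings_image:
  assumes "f \<in> embeddings E v S" "simple_graph V E" "v \<in> V"
  shows "f ` S \<subseteq> V"
proof
  fix x assume "x \<in> f ` S"
  then obtain q where q: "q \<in> S" "x = f q" by auto
  show "x \<in> V"
  proof (cases q rule: rev_cases)
    case Nil
    then show ?thesis using q assms embeddingsD(1) by metis
  next
    case (snoc p i)
    then show ?thesis using q simple_graphD(4)[OF assms(2)] embeddingsD(3)[OF assms(1)] by metis
  qed
qed

lemma finite_embeddings:
  assumes "simple_graph V E" "v \<in> V" "finite S"
  shows "finite (embeddings E v S)"
proof (rule finite_subset)
  show "embeddings E v S \<subseteq> S \<rightarrow>\<^sub>E V"
  proof
    fix f assume f: "f \<in> embeddings E v S"
    show "f \<in> S \<rightarrow>\<^sub>E V"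
      using embeddings_image[OF f assms(1,2)] embeddingsD(4)[OF f] by (auto simp: PiE_def)
  qed
  show "finite (S \<rightarrow>\<^sub>E V)" using simple_graphD(1)[OF assms(1)] assms(3) by (simp add: finite_PiE)
qed

lemma ball_mapsD:
  assumes "f \<in> ball_maps E r v S E'"
  shows "f \<in> embeddings E v S" "open_edges f S \<subseteq> E'" "closed_edges E r f S \<inter> E' = {}"
  using assms unfolding ball_maps_def by auto

lemma finite_ball_maps:
  assumes "simple_graph V E" "v \<in> V" "finite S"
  shows "finite (ball_maps E r v S E')"
  using finite_embeddings[OF assms] unfolding ball_maps_def by auto

section \<open>The ball described by a ball map\<close>

lemma dist_le_mono: "dist_le E j v w \<Longrightarrow> j \<le> k \<Longrightarrow> dist_le E k v w"
proof (induction k)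
  case (Suc k)
  then show ?case by (cases "j = Suc k") auto
qed simp

lemma open_edges_cases:
  assumes "inj_on f S" "plane_tree r S" "q \<in> S" "{f q, w} \<in> open_edges f S"
  obtains i where "q @ [i] \<in> S" "w = f (q @ [i])" | p i where "q = p @ [i]" "w = f p" "p \<in> S"
proof -
  obtain p i where p: "p @ [i] \<in> S" "{f q, w} = {f p, f (p @ [i])}"
    using assms(4) by (auto simp: open_edges_def)
  have pS: "p \<in> S" using plane_treeD(3)[OF assms(2) p(1)] .
  consider "f q = f p" "w = f (p @ [i])" | "f q = f (p @ [i])" "w = f p"
    using p(2) by (metis doubleton_eq_iff)
  then show thesis
  proof cases
    case 1
    then have "q = p" using assms(1,3) pS by (meson inj_onD)
    then show thesis using 1 p(1) that(1) by blast
  next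
    case 2
    then have "q = p @ [i]" using assms(1,3) p(1) by (meson inj_onD)
    then show thesis using 2 pS that(2) by blast
  qed
qed

text \<open>At a vertex of depth below \<open>r\<close> every edge of \<open>E'\<close> is a tree
  edge, the other edges of \<open>E\<close> there being closed. So a step leads to a child or to the
  parent, and after \<open>j\<close> steps the depth is at most \<open>j\<close>. Conversely all
  tree edges are open.\<close>

lemma ball_map_dist:
  assumes S: "plane_tree r S" and f: "f \<in> ball_maps E r v S E'" and sub: "E' \<subseteq> E" and "j \<le> r"
  shows "dist_le E' j v w \<longleftrightarrow> (\<exists>q\<in>S. length q \<le> j \<and> f q = w)"
proof
  note fD = ball_mapsD[OF f] and eD = embeddingsD[OF ball_mapsD(1)[OF f]]
  show "\<exists>q\<in>S. length q \<le> j \<and> f q = w" if "dist_le E' j v w"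
    using that \<open>j \<le> r\<close>
  proof (induction j arbitrary: w)
    case 0
    then show ?case using eD(1) plane_treeD(2)[OF S] by auto
  next
    case (Suc j)
    show ?case
    proof (cases "dist_le E' j v w")
      case True
      then obtain q where "q \<in> S" "length q \<le> j" "f q = w" using Suc by auto
      then show ?thesis by (intro bexI[of _ q]) auto
    next
      case False
      then obtain u where u: "dist_le E' j v u" "{u, w} \<in> E'" using Suc.prems by auto
      then obtain q where q: "q \<in> S" "length q \<le> j" "f q = u" using Suc by auto
      have "{f q, w} \<notin> closed_edges E r f S" using fD(3) u(2) q(3) by auto
      then have "{f q, w} \<in> open_edges f S"
        using u(2) q Suc.prems sub unfolding closed_edges_def by auto
      from eD(2) S q(1) this show ?thesis
      proof (cases rule: open_edges_cases)
        case (1 i)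
        then show ?thesis using q by (intro bexI[of _ "q @ [i]"]) auto
      next
        case (2 p i)
        then show ?thesis using q by (intro bexI[of _ p]) auto
      qed
    qed
  qed
  show "dist_le E' j v w" if "\<exists>q\<in>S. length q \<le> j \<and> f q = w"
  proof -
    from that obtain q where q: "q \<in> S" "length q \<le> j" "f q = w" by auto
    have "dist_le E' (length q) v (f q)" using q(1)
    proof (induction q rule: rev_induct)
      case Nil
      then show ?case using eD(1) by simp
    next
      case (snoc i p)
      have "{f p, f (p @ [i])} \<in> E'" using snoc.prems fD(2) by (auto simp: open_edges_def)
      then show ?case using snoc plane_treeD(3)[OF S] by auto
    qed
    then show ?thesis using q dist_le_mono by metis
  qed
qed

lemma ball_map_ball:
  assumes S: "plane_tree r S" and f: "f \<in> ball_maps E r v S E'" and sub: "E' \<subseteq> E"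
    and G: "simple_graph V E" "v \<in> V"
  shows "ball V E' r v = (f ` S, open_edges f S, v)"
proof -
  note fD = ball_mapsD[OF f]
  have V: "{w \<in> V. dist_le E' r v w} = f ` S"
    using ball_map_dist[OF S f sub order.refl] plane_treeD(5)[OF S] embeddings_image[OF fD(1) G] by auto
  have "open_edges f S \<subseteq> Pow (f ` S)"
    using plane_treeD(3)[OF S] by (auto simp: open_edges_def)
  then have "{e \<in> E'. e \<subseteq> f ` S} = open_edges f S"
    using fD(2,3) sub by (auto simp: closed_edges_def)
  then show ?thesis unfolding ball_def Let_def V by simp
qed

lemma ball_map_iso:
  assumes S: "plane_tree r S" and f: "f \<in> ball_maps E r v S E'" and sub: "E' \<subseteq> E"
    and G: "simple_graph V E" "v \<in> V"
  shows "rg_iso (ball V E' r v) (tree_of S)"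
proof -
  note eD = embeddingsD[OF ball_mapsD(1)[OF f]]
  let ?g = "inv_into S f"
  have bij: "bij_betw ?g (f ` S) S"
    using eD(2) by (intro bij_betw_inv_into) (simp add: inj_on_imp_bij_betw)
  have root: "?g v = []" using eD(1,2) plane_treeD(2)[OF S] by (metis inv_into_f_f)
  have edge: "{f q, f q'} \<in> open_edges f S \<longleftrightarrow> {q, q'} \<in> {{p, p @ [i]} |p i. p @ [i] \<in> S}"
    if "q \<in> S" "q' \<in> S" for q q'
  proof
    assume "{f q, f q'} \<in> open_edges f S"
    from eD(2) S that(1) this show "{q, q'} \<in> {{p, p @ [i]} |p i. p @ [i] \<in> S}"
    proof (cases rule: open_edges_cases)
      case (1 i)
      then have "q' = q @ [i]" using eD(2) that(2) by (meson inj_onD)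
      then show ?thesis using 1 by auto
    next
      case (2 p i)
      then have "q' = p" using eD(2) that(2) by (meson inj_onD)
      then show ?thesis using 2 that by (auto simp: insert_commute)
    qed
  next
    assume "{q, q'} \<in> {{p, p @ [i]} |p i. p @ [i] \<in> S}"
    then obtain p i where p: "{q, q'} = {p, p @ [i]}" "p @ [i] \<in> S" by auto
    have "{f q, f q'} = f ` {q, q'}" by simp
    then show "{f q, f q'} \<in> open_edges f S" using p by (auto simp: open_edges_def)
  qed
  have edge': "{x, y} \<in> open_edges f S \<longleftrightarrow> {?g x, ?g y} \<in> {{p, p @ [i]} |p i. p @ [i] \<in> S}"
    if "x \<in> f ` S" "y \<in> f ` S" for x y
    using edge[of "?g x" "?g y"] that by (simp add: inv_into_into f_inv_into_f)
  show ?thesis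
    unfolding ball_map_ball[OF assms] rg_iso_def tree_of_def prod.case
    by (intro exI[of _ ?g] conjI ballI bij root edge')
qed

text \<open>The left side involves only \<open>E'\<close>, \<open>v\<close> and the vertex
  \<open>f q\<close>. Hence the unordered set of children is intrinsic to the ball, and two ball
  maps at \<open>v\<close> can differ only in how they order these sets.\<close>

lemma ball_map_children:
  assumes S: "plane_tree r S" and f: "f \<in> ball_maps E r v S E'" and sub: "E' \<subseteq> E" and q: "q \<in> S"
  shows "{w. {f q, w} \<in> E' \<and> (\<exists>j<r. dist_le E' j v (f q) \<and> \<not> dist_le E' j v w)} =
    (\<lambda>i. f (q @ [i])) ` {..<nchild S q}" (is "?L = ?R")
proof (rule set_eqI, rule iffI)
  note fD = ball_mapsD[OF f] and eD = embeddingsD[OF ball_mapsD(1)[OF f]]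
  have dist: "dist_le E' j v (f p) \<longleftrightarrow> length p \<le> j" if "p \<in> S" "j \<le> r" for p j
    using ball_map_dist[OF S f sub that(2)] that(1) eD(2) by (metis inj_onD)
  fix w
  show "w \<in> ?R" if w: "w \<in> ?L"
  proof -
    from w obtain j where j: "{f q, w} \<in> E'" "j < r" "dist_le E' j v (f q)" "\<not> dist_le E' j v w" by auto
    have len: "length q \<le> j" using dist[OF q] j by simp
    have "{f q, w} \<notin> closed_edges E r f S" using fD(3) j by auto
    then have "{f q, w} \<in> open_edges f S"
      using j q len sub unfolding closed_edges_def by auto
    from eD(2) S q this show ?thesis
    proof (cases rule: open_edges_cases)
      case (1 i)
      then show ?thesis using less_nchild_iff[OF S] by auto
    next
      case (2 p i)
      then have "dist_le E' j v w" using dist[of p j] len j by auto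
      then show ?thesis using j by simp
    qed
  qed
  show "w \<in> ?L" if w: "w \<in> ?R"
  proof -
    from w obtain i where i: "w = f (q @ [i])" "q @ [i] \<in> S" using less_nchild_iff[OF S] by auto
    have "length q < r" using plane_treeD(5)[OF S i(2)] by simp
    then have "dist_le E' (length q) v (f q)" "\<not> dist_le E' (length q) v w"
      using dist q i by auto
    moreover have "{f q, w} \<in> E'" using i fD(2) by (auto simp: open_edges_def)
    ultimately show ?thesis using \<open>length q < r\<close> by auto
  qed
qed

text \<open>A pair \<open>(S, f)\<close> amounts to an ordering of the children of every vertex of the ball, and the
  ball has \<open>orderings S\<close> of these.\<close>
lemma sum_ball_maps_le_1:
  assumes G: "simple_graph V E" "v \<in> V" and sub: "E' \<subseteq> E"
    and fin: "finite \<S>" and trees: "\<And>S. S \<in> \<S> \<Longrightarrow> plane_tree r S"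
  shows "(\<Sum>S\<in>\<S>. real (card (ball_maps E r v S E')) / real (orderings S)) \<le> 1"
proof -
  let ?M = "\<lambda>S. ball_maps E r v S E'"
  define P where "P = (SIGMA S:\<S>. ?M S)"
  have finM: "finite (?M S)" if "S \<in> \<S>" for S
    using finite_ball_maps[OF G] plane_treeD(1)[OF trees[OF that]] by blast
  \<comment> \<open>The children of \<open>u\<close> in the ball, read off from distances:
    \<open>u\<close> is at distance less than \<open>r\<close> from \<open>v\<close>, and
    \<open>w\<close> is farther from \<open>v\<close> than \<open>u\<close>. Accordingly
    \<open>Q\<close> below counts the orderings of the ball without reference to any
    \<open>(S, f)\<close>.\<close>
  define C where "C u = {w. {u, w} \<in> E' \<and> (\<exists>j<r. dist_le E' j v u \<and> \<not> dist_le E' j v w)}" for u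
  define B where "B = fst (ball V E' r v)"
  define Q where "Q = (\<Prod>u\<in>B. fact (card (C u)) :: nat)"
  have P: "plane_tree r S" "f ` S = B" "inj_on f S" "f [] = v" "f \<in> extensional S"
     "\<And>q. q \<in> S \<Longrightarrow> C (f q) = (\<lambda>i. f (q @ [i])) ` {..<nchild S q}"
     "\<And>q. inj_on (\<lambda>i. f (q @ [i])) {..<nchild S q}"
     "\<And>q. q \<in> S \<Longrightarrow> card (C (f q)) = nchild S q"
     if "(S, f) \<in> P" for S f
  proof -
    have S: "plane_tree r S" and f: "f \<in> ?M S" using that trees by (auto simp: P_def)
    note eD = embeddingsD[OF ball_mapsD(1)[OF f]]
    show "plane_tree r S" by (fact S)
    show "f ` S = B" using ball_map_ball[OF S f sub G] by (simp add: B_def)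
    show "inj_on f S" "f [] = v" "f \<in> extensional S" using eD by auto
    show C: "C (f q) = (\<lambda>i. f (q @ [i])) ` {..<nchild S q}" if "q \<in> S" for q
      unfolding C_def by (rule ball_map_children[OF S f sub that])
    show I: "inj_on (\<lambda>i. f (q @ [i])) {..<nchild S q}" for q
      using eD(2) less_nchild_iff[OF S] unfolding inj_on_def by auto
    show "card (C (f q)) = nchild S q" if "q \<in> S" for q
      using C[OF that] I[of q] by (simp add: card_image)
  qed
  have ord: "orderings S = Q" if "(S, f) \<in> P" for S f
  proof -
    have "Q = (\<Prod>q\<in>S. fact (card (C (f q))))"
      unfolding Q_def P(2)[OF that, symmetric] by (subst prod.reindex[OF P(3)[OF that]]) simp
    then show ?thesis unfolding orderings_def using P(8)[OF that] by simp
  qed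
  \<comment> \<open>Each pair is encoded by the list of children of every ball vertex, in the order
    that the labels of \<open>S\<close> induce.\<close>
  define \<sigma> where "\<sigma> = (\<lambda>(S, f). \<lambda>u\<in>B. map (\<lambda>i. f (inv_into S f u @ [i])) [0..<card (C u)])"
  have \<sigma>: "\<sigma> (S, f) (f q) = map (\<lambda>i. f (q @ [i])) [0..<nchild S q]" if "(S, f) \<in> P" "q \<in> S" for S f q
    using that P(2,3,8)[OF that(1)] by (auto simp: \<sigma>_def)
  have "\<sigma> ` P \<subseteq> PiE B (\<lambda>u. permutations_of_set (C u))"
  proof (rule image_subsetI, clarify, rule PiE_I)
    fix S f u assume Sf: "(S, f) \<in> P" and "u \<in> B"
    then obtain q where q: "q \<in> S" "u = f q" using P(2) by blast
    show "\<sigma> (S, f) u \<in> permutations_of_set (C u)"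
      unfolding q(2) \<sigma>[OF Sf q(1)] P(6)[OF Sf q(1)]
      using P(7)[OF Sf] by (intro permutations_of_setI) (auto simp: distinct_map atLeast0LessThan)
  next
    fix S f u assume "u \<notin> B" then show "\<sigma> (S, f) u = undefined" by (simp add: \<sigma>_def)
  qed
  moreover have "inj_on \<sigma> P"
  proof (rule inj_onI, clarify)
    fix S f S' f' assume A: "(S, f) \<in> P" "(S', f') \<in> P" "\<sigma> (S, f) = \<sigma> (S', f')"
    \<comment> \<open>The lists rebuild the tree and the map from the root downwards: the list at
      \<open>f q\<close> gives the number of children of \<open>q\<close> and their images.\<close>
    have 1: "(q \<in> S \<longleftrightarrow> q \<in> S') \<and> (q \<in> S \<longrightarrow> f q = f' q)" for q
    proof (induction q rule: rev_induct)
      case Nil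
      then show ?case using P(1,4)[OF A(1)] P(1,4)[OF A(2)] plane_treeD(2) by auto
    next
      case (snoc i q)
      show ?case
      proof (cases "q \<in> S")
        case True
        then have q: "q \<in> S'" "f q = f' q" using snoc by auto
        have eq: "map (\<lambda>i. f (q @ [i])) [0..<nchild S q] = map (\<lambda>i. f' (q @ [i])) [0..<nchild S' q]"
          using \<sigma>[OF A(1) True] \<sigma>[OF A(2) q(1)] A(3) q(2) by simp
        then have n: "nchild S q = nchild S' q" by (metis length_map length_upt diff_zero)
        have "f (q @ [i]) = f' (q @ [i])" if "i < nchild S q" for i
          using eq that n by auto
        then show ?thesis
          using n less_nchild_iff[OF P(1)[OF A(1)]] less_nchild_iff[OF P(1)[OF A(2)]] by metis
      next
        case False
        then show ?thesis
          using snoc plane_treeD(3)[OF P(1)[OF A(1)]] plane_treeD(3)[OF P(1)[OF A(2)]] by blast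
      qed
    qed
    then have "S = S'" by auto
    moreover have "f = f'"
      using 1 P(5)[OF A(1)] P(5)[OF A(2)] \<open>S = S'\<close> by (intro extensionalityI) auto
    ultimately show "S = S' \<and> f = f'" by simp
  qed
  moreover have finB: "finite B"
    using simple_graphD(1)[OF G(1)] by (simp add: B_def ball_def Let_def)
  moreover have finC: "finite (C u)" for u
  proof -
    have "C u \<subseteq> V" using simple_graphD(4)[OF G(1)] sub by (auto simp: C_def)
    then show ?thesis using simple_graphD(1)[OF G(1)] finite_subset by blast
  qed
  ultimately have "card P \<le> card (PiE B (\<lambda>u. permutations_of_set (C u)))"
    by (intro card_inj_on_le) (auto intro!: finite_PiE)
  also have "\<dots> = Q"
    unfolding Q_def using finB finC by (simp add: card_PiE card_permutations_of_set)
  finally have le: "card P \<le> Q" .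
  have "(\<Sum>S\<in>\<S>. real (card (?M S)) / real (orderings S)) = (\<Sum>S\<in>\<S>. real (card (?M S)) / real Q)"
  proof (rule sum.cong[OF refl])
    fix S assume "S \<in> \<S>"
    show "real (card (?M S)) / real (orderings S) = real (card (?M S)) / real Q"
    proof (cases "?M S = {}")
      case False
      then obtain f where "(S, f) \<in> P" using \<open>S \<in> \<S>\<close> by (auto simp: P_def)
      then show ?thesis using ord by simp
    qed simp
  qed
  also have "\<dots> = real (card P) / real Q"
    unfolding P_def using fin finM by (simp add: sum_divide_distrib)
  also have "\<dots> \<le> 1" using le by (simp add: divide_le_eq)
  finally show ?thesis .
qed

section \<open>Percolation on a regular graph\<close>

lemma set_random_subgraph: "E' \<in> set_pmf (random_subgraph E p) \<Longrightarrow> E' \<subseteq> E"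
  unfolding random_subgraph_def by auto

lemma finite_set_random_subgraph: "finite E \<Longrightarrow> finite (set_pmf (random_subgraph E p))"
  using set_random_subgraph[of _ E p] by (meson Pow_iff finite_Pow_iff finite_subset subsetI)

lemma random_subgraph_cylinder:
  assumes "finite E" "A \<subseteq> E" "B \<subseteq> E" "A \<inter> B = {}" "0 \<le> p" "p \<le> 1"
  shows "measure_pmf.prob (random_subgraph E p) {E'. A \<subseteq> E' \<and> B \<inter> E' = {}} = p ^ card A * (1 - p) ^ card B"
proof -
  let ?X = "\<lambda>e. if e \<in> A then {True} else if e \<in> B then {False} else UNIV"
  let ?P = "Pi_pmf E False (\<lambda>_. bernoulli_pmf p)"
  have fin: "finite A" "finite B" using assms finite_subset by blast+
  have eq: "(\<lambda>f. {e \<in> E. f e}) -` {E'. A \<subseteq> E' \<and> B \<inter> E' = {}} = Pi E ?X"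
    using assms(2-4) by (auto simp: Pi_def split: if_splits)
  have "measure_pmf.prob (random_subgraph E p) {E'. A \<subseteq> E' \<and> B \<inter> E' = {}} = measure_pmf.prob ?P (Pi E ?X)"
    unfolding random_subgraph_def measure_map_pmf eq ..
  also have "\<dots> = (\<Prod>e\<in>E. measure_pmf.prob (bernoulli_pmf p) (?X e))"
    by (rule measure_Pi_pmf_Pi[OF assms(1)])
  also have "\<dots> = (\<Prod>e\<in>E. (if e \<in> A then p else 1) * (if e \<in> B then 1 - p else 1))"
    using assms(4-6) by (intro prod.cong) (auto simp: measure_pmf_single)
  also have "\<dots> = (\<Prod>e\<in>E. if e \<in> A then p else 1) * (\<Prod>e\<in>E. if e \<in> B then 1 - p else 1)"
    by (rule prod.distrib)
  also have "(\<Prod>e\<in>E. if e \<in> A then p else 1) = p ^ card A"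
    using prod.inter_restrict[OF assms(1), of "\<lambda>_. p" A] assms(2) by (simp add: Int_absorb1)
  also have "(\<Prod>e\<in>E. if e \<in> B then 1 - p else 1) = (1 - p) ^ card B"
    using prod.inter_restrict[OF assms(1), of "\<lambda>_. 1 - p" B] assms(3) by (simp add: Int_absorb1)
  finally show ?thesis .
qed

lemma random_subgraph_Int:
  assumes "finite E" "E2 \<subseteq> E"
  shows "map_pmf (\<lambda>E'. E' \<inter> E2) (random_subgraph E p) = random_subgraph E2 p"
proof -
  have "random_subgraph E2 p = map_pmf (\<lambda>f. {e \<in> E2. f e})
     (map_pmf (\<lambda>f x. if x \<in> E2 then f x else False) (Pi_pmf E False (\<lambda>_. bernoulli_pmf p)))"
    unfolding random_subgraph_def by (subst Pi_pmf_subset[OF assms]) simp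
  also have "\<dots> = map_pmf (\<lambda>E'. E' \<inter> E2) (random_subgraph E p)"
    unfolding random_subgraph_def map_pmf_comp using assms(2)
    by (intro map_pmf_cong) auto
  finally show ?thesis by simp
qed

lemma random_subgraph_insert:
  assumes "finite E" "e \<notin> E"
  shows "random_subgraph (insert e E) p =
    bind_pmf (bernoulli_pmf p) (\<lambda>b. map_pmf (\<lambda>E'. if b then insert e E' else E') (random_subgraph E p))"
  unfolding random_subgraph_def Pi_pmf_insert'[OF assms] map_bind_pmf map_pmf_comp
  unfolding map_pmf_def[symmetric] map_pmf_comp map_return_pmf
  using assms(2) by (intro bind_pmf_cong refl map_pmf_cong) auto

text \<open>Revealing \<open>e\<close> first leaves a random subgraph of \<open>E - {e}\<close>,
  whose trace on \<open>E2\<close> is again a random subgraph. This is how the first edge of a path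
  is separated from the rest.\<close>

lemma random_subgraph_edge_indep:
  assumes "finite E" "e \<in> E" "E2 \<subseteq> E - {e}" "0 \<le> p" "p \<le> 1"
  shows "measure_pmf.prob (random_subgraph E p) {E'. e \<in> E' \<and> Q (E' \<inter> E2)} =
    p * measure_pmf.prob (random_subgraph E2 p) {E'. Q E'}"
proof -
  let ?R = "random_subgraph (E - {e}) p"
  let ?A = "{E'. e \<in> E' \<and> Q (E' \<inter> E2)}"
  have E: "E = insert e (E - {e})" using assms(2) by auto
  have 1: "measure_pmf.prob (map_pmf (\<lambda>E'. if b then insert e E' else E') ?R) ?A =
      (if b then measure_pmf.prob (random_subgraph E2 p) {E'. Q E'} else 0)" for b
  proof (cases b)
    case True
    have "measure_pmf.prob (map_pmf (\<lambda>E'. insert e E') ?R) ?A = measure_pmf.prob ?R {E'. Q (E' \<inter> E2)}"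
      unfolding measure_map_pmf
      using assms(3) by (intro arg_cong[where f="measure_pmf.prob ?R"]) (auto simp: Int_insert_left)
    also have "\<dots> = measure_pmf.prob (map_pmf (\<lambda>E'. E' \<inter> E2) ?R) {E'. Q E'}"
      unfolding measure_map_pmf by (simp add: vimage_def)
    also have "\<dots> = measure_pmf.prob (random_subgraph E2 p) {E'. Q E'}"
      using assms(1,3) by (subst random_subgraph_Int) auto
    finally show ?thesis using True by simp
  next
    case False
    have "measure_pmf.prob ?R ?A = measure_pmf.prob ?R (?A \<inter> set_pmf ?R)"
      by (simp add: measure_Int_set_pmf)
    also have "?A \<inter> set_pmf ?R = {}" using set_random_subgraph[of _ "E - {e}" p] by auto
    finally show ?thesis using False by simp
  qed
  have "random_subgraph E p = bind_pmf (bernoulli_pmf p) (\<lambda>b. map_pmf (\<lambda>E'. if b then insert e E' else E') ?R)"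
    by (subst E, rule random_subgraph_insert) (use assms(1) in auto)
  then have "measure_pmf.prob (random_subgraph E p) ?A =
      measure_pmf.expectation (bernoulli_pmf p)
        (\<lambda>b. if b then measure_pmf.prob (random_subgraph E2 p) {E'. Q E'} else 0)"
    by (simp only: measure_bind_pmf_expectation 1)
  then show ?thesis using assms(4,5) by simp
qed

text \<open>The walk is cut at its last visit to \<open>v\<close>. What follows the next edge avoids
  all edges at \<open>v\<close>, which makes it independent of that edge in the random
  subgraph.\<close>

lemma dist_le_first_step:
  assumes "dist_le E j v w"
  shows "v = w \<or> (\<exists>y i. i < j \<and> {v, y} \<in> E \<and> dist_le {e \<in> E. v \<notin> e} i y w)"
  using assms
proof (induction j arbitrary: w)
  case (Suc j)
  show ?case
  proof (cases "dist_le E j v w")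
    case True
    then show ?thesis using Suc.IH less_SucI by blast
  next
    case False
    then obtain u where u: "dist_le E j v u" "{u, w} \<in> E" using Suc.prems by auto
    show ?thesis
    proof (cases "v = w \<or> v = u")
      case True
      then show ?thesis using u by (auto intro!: exI[of _ w] exI[of _ 0])
    next
      case False
      then obtain y i where y: "i < j" "{v, y} \<in> E" "dist_le {e \<in> E. v \<notin> e} i y u"
        using Suc.IH[OF u(1)] by auto
      have "dist_le {e \<in> E. v \<notin> e} (Suc i) y w"
        using y(3) u(2) False by auto
      then show ?thesis using y(1,2) by (meson Suc_mono)
    qed
  qed
qed simp

text \<open>The expected size of a ball is bounded as for a branching process with mean offspring
  \<open>d * p\<close>: reveal the edges at \<open>v\<close>, then continue from each neighbour in
  the graph without these edges. Deleting edges destroys regularity, so the induction runs over all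
  graphs of maximum degree at most \<open>d\<close>.\<close>

lemma sum_prob_dist_le:
  assumes "simple_graph V E" "\<And>x. card {y. {x, y} \<in> E} \<le> d" "0 \<le> p" "p \<le> 1"
  shows "(\<Sum>w\<in>V. measure_pmf.prob (random_subgraph E p) {E'. dist_le E' j v w}) \<le> (\<Sum>i\<le>j. (real d * p) ^ i)"
  using assms(1,2)
proof (induction j arbitrary: E v)
  case 0
  have "(\<Sum>w\<in>V. measure_pmf.prob (random_subgraph E p) {E'. dist_le E' 0 v w}) = (\<Sum>w\<in>V. if v = w then 1 else 0)"
    by (intro sum.cong) auto
  also have "\<dots> \<le> 1" using simple_graphD(1)[OF 0(1)] by simp
  finally show ?case by simp
next
  case (Suc j)
  note V = simple_graphD[OF Suc.prems(1)]
  let ?E2 = "{e \<in> E. v \<notin> e}"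
  let ?R = "random_subgraph E p" and ?R2 = "random_subgraph ?E2 p"
  let ?N = "{y. {v, y} \<in> E}"
  have "?N \<subseteq> V" using V(4) by auto
  then have finN: "finite ?N" using V(1) finite_subset by blast
  have G2: "simple_graph V ?E2" using Suc.prems(1) unfolding simple_graph_def by auto
  have deg2: "card {y. {x, y} \<in> ?E2} \<le> d" for x
  proof -
    have "{y. {x, y} \<in> E} \<subseteq> V" using V(4) by auto
    then have "card {y. {x, y} \<in> ?E2} \<le> card {y. {x, y} \<in> E}"
      using V(1) by (intro card_mono) (auto intro: finite_subset)
    then show ?thesis using Suc.prems(2)[of x] by simp
  qed
  have step: "measure_pmf.prob ?R {E'. dist_le E' (Suc j) v w} \<le>
     (if v = w then 1 else 0) + (\<Sum>y\<in>?N. p * measure_pmf.prob ?R2 {E'. dist_le E' j y w})" for w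
  proof (cases "v = w")
    case True
    have "measure_pmf.prob ?R {E'. dist_le E' (Suc j) v w} \<le> 1" by simp
    also have "\<dots> \<le> 1 + (\<Sum>y\<in>?N. p * measure_pmf.prob ?R2 {E'. dist_le E' j y w})"
      using assms(3) by (simp add: sum_nonneg)
    finally show ?thesis using True by simp
  next
    case False
    have "measure_pmf.prob ?R {E'. dist_le E' (Suc j) v w} =
        measure_pmf.prob ?R ({E'. dist_le E' (Suc j) v w} \<inter> set_pmf ?R)"
      by (simp add: measure_Int_set_pmf)
    also have "\<dots> \<le> measure_pmf.prob ?R (\<Union>y\<in>?N. {E'. {v, y} \<in> E' \<and> dist_le (E' \<inter> ?E2) j y w})"
    proof (intro measure_pmf.finite_measure_mono subsetI)
      fix E' assume "E' \<in> {E'. dist_le E' (Suc j) v w} \<inter> set_pmf ?R"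
      then have E': "dist_le E' (Suc j) v w" "E' \<subseteq> E" using set_random_subgraph by blast+
      from dist_le_first_step[OF E'(1)] False obtain y i where
        y: "i < Suc j" "{v, y} \<in> E'" "dist_le {e \<in> E'. v \<notin> e} i y w" by auto
      have "{e \<in> E'. v \<notin> e} = E' \<inter> ?E2" using E'(2) by auto
      then have "dist_le (E' \<inter> ?E2) j y w" using dist_le_mono[OF y(3), of j] y(1) by simp
      then show "E' \<in> (\<Union>y\<in>?N. {E'. {v, y} \<in> E' \<and> dist_le (E' \<inter> ?E2) j y w})"
        using y(2) E'(2) by auto
    qed simp
    also have "\<dots> \<le> (\<Sum>y\<in>?N. measure_pmf.prob ?R {E'. {v, y} \<in> E' \<and> dist_le (E' \<inter> ?E2) j y w})"
      using finN by (intro measure_pmf.finite_measure_subadditive_finite) auto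
    also have "\<dots> = (\<Sum>y\<in>?N. p * measure_pmf.prob ?R2 {E'. dist_le E' j y w})"
      using V(6) assms(3,4) by (intro sum.cong refl random_subgraph_edge_indep) auto
    finally show ?thesis using False by simp
  qed
  have "(\<Sum>w\<in>V. measure_pmf.prob ?R {E'. dist_le E' (Suc j) v w}) \<le>
     (\<Sum>w\<in>V. (if v = w then 1 else 0) + (\<Sum>y\<in>?N. p * measure_pmf.prob ?R2 {E'. dist_le E' j y w}))"
    by (rule sum_mono[OF step])
  also have "\<dots> = (\<Sum>w\<in>V. if v = w then 1 else 0) +
      (\<Sum>y\<in>?N. p * (\<Sum>w\<in>V. measure_pmf.prob ?R2 {E'. dist_le E' j y w}))"
    unfolding sum.distrib sum_distrib_left by (subst sum.swap) simp
  also have "\<dots> \<le> 1 + (\<Sum>y\<in>?N. p * (\<Sum>i\<le>j. (real d * p) ^ i))"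
    using V(1) assms(3) Suc.IH[OF G2 deg2] by (intro add_mono sum_mono mult_left_mono) auto
  also have "\<dots> \<le> 1 + real d * (p * (\<Sum>i\<le>j. (real d * p) ^ i))"
    using Suc.prems(2)[of v] assms(3) by (auto intro!: mult_right_mono mult_nonneg_nonneg sum_nonneg)
  also have "\<dots> = (\<Sum>i\<le>Suc j. (real d * p) ^ i)"
    unfolding sum.atMost_Suc_shift by (simp add: sum_distrib_left mult.assoc)
  finally show ?case .
qed

section \<open>Counting edges and embeddings in a regular graph\<close>

lemma regular_card_neighbours:
  assumes "simple_graph V E" "regular d V E" "v \<in> V"
  shows "card {y. {v, y} \<in> E} = d"
proof -
  have "bij_betw (\<lambda>y. {v, y}) {y. {v, y} \<in> E} {e \<in> E. v \<in> e}"
  proof (rule bij_betw_imageI)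
    show "inj_on (\<lambda>y. {v, y}) {y. {v, y} \<in> E}" by (auto simp: inj_on_def doubleton_eq_iff)
    show "(\<lambda>y. {v, y}) ` {y. {v, y} \<in> E} = {e \<in> E. v \<in> e}"
    proof (intro equalityI subsetI)
      fix e assume e: "e \<in> {e \<in> E. v \<in> e}"
      then obtain x y where "e = {x, y}" using simple_graph_edgeE[OF assms(1)] by blast
      then show "e \<in> (\<lambda>y. {v, y}) ` {y. {v, y} \<in> E}" using e by (auto simp: insert_commute)
    qed auto
  qed
  then have "card {y. {v, y} \<in> E} = card {e \<in> E. v \<in> e}" by (rule bij_betw_same_card)
  then show ?thesis using assms(2,3) by (simp add: regular_def)
qed

lemma finite_neighbours: "simple_graph V E \<Longrightarrow> finite {y. {v, y} \<in> E}"
  using simple_graphD(1,4)[of V E] by (metis (mono_tags, lifting) finite_subset mem_Collect_eq subsetI)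

lemma regular_card_neighbours_le:
  assumes "simple_graph V E" "regular d V E"
  shows "card {y. {v, y} \<in> E} \<le> d"
proof (cases "v \<in> V")
  case False
  then have "{y. {v, y} \<in> E} = {}" using simple_graphD(3)[OF assms(1)] by auto
  then show ?thesis by simp
qed (use regular_card_neighbours[OF assms] in simp)

text \<open>A vertex has \<open>d\<close> distinct neighbours in \<open>V\<close>. This turns the
  \<open>1 / card V\<close> coming from pairs of nearby vertices into \<open>1 / d\<close>.\<close>

lemma regular_card_vertices:
  assumes "simple_graph V E" "regular d V E" "V \<noteq> {}"
  shows "d \<le> card V"
proof -
  obtain v where v: "v \<in> V" using assms(3) by auto
  have "{y. {v, y} \<in> E} \<subseteq> V" using simple_graphD(4)[OF assms(1)] by auto
  then show ?thesis
    using regular_card_neighbours[OF assms(1,2) v] simple_graphD(1)[OF assms(1)] card_mono by metis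
qed

text \<open>Only edges with exactly one end in \<open>U\<close> are counted, so none is counted
  twice; each vertex of \<open>U\<close> has at least \<open>d - card U\<close> of them.\<close>

lemma card_incident_ge:
  assumes "simple_graph V E" "regular d V E" "U \<subseteq> V"
  shows "card U * (d - card U) \<le> card {e \<in> E. \<exists>u\<in>U. u \<in> e}"
proof -
  let ?P = "SIGMA u:U. {y. {u, y} \<in> E} - U"
  note V = simple_graphD[OF assms(1)]
  have U: "finite U" using assms(3) V(1) finite_subset by blast
  have "(\<Sum>u\<in>U. d - card U) \<le> (\<Sum>u\<in>U. card ({y. {u, y} \<in> E} - U))"
  proof (rule sum_mono)
    fix u assume "u \<in> U"
    then have "d - card U = card {y. {u, y} \<in> E} - card U"
      using regular_card_neighbours[OF assms(1,2)] assms(3) by auto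
    also have "\<dots> \<le> card ({y. {u, y} \<in> E} - U)" using U by (rule diff_card_le_card_Diff)
    finally show "d - card U \<le> card ({y. {u, y} \<in> E} - U)" .
  qed
  also have "\<dots> = card ?P" using U finite_neighbours[OF assms(1)] by simp
  also have "\<dots> = card ((\<lambda>(u, y). {u, y}) ` ?P)"
    by (rule card_image[symmetric]) (auto simp: inj_on_def doubleton_eq_iff)
  also have "\<dots> \<le> card {e \<in> E. \<exists>u\<in>U. u \<in> e}" using V(6) by (intro card_mono) auto
  finally show ?thesis by simp
qed

text \<open>Extending an embedding to a new leaf below \<open>q\<close> means choosing a neighbour
  of \<open>f q\<close> that is not yet used.\<close>

lemma card_embeddings_insert:
  assumes "simple_graph V E" "v \<in> V" "finite S" "[] \<in> S" "q \<in> S" "q @ [i] \<notin> S"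
    and closed: "\<And>p j. p @ [j] \<in> S \<Longrightarrow> p \<in> S"
  shows "card (embeddings E v (insert (q @ [i]) S)) =
    (\<Sum>f\<in>embeddings E v S. card ({y. {f q, y} \<in> E} - f ` S))"
proof -
  let ?x = "q @ [i]"
  let ?P = "SIGMA f:embeddings E v S. {y. {f q, y} \<in> E} - f ` S"
  have "bij_betw (\<lambda>(f, y). f(?x := y)) ?P (embeddings E v (insert ?x S))"
  proof (rule bij_betw_byWitness[where f'="\<lambda>g. (restrict g S, g ?x)"])
    show "\<forall>a\<in>?P. (restrict ((\<lambda>(f, y). f(?x := y)) a) S, (\<lambda>(f, y). f(?x := y)) a ?x) = a"
    proof (clarsimp)
      fix f assume "f \<in> embeddings E v S"
      then have "f \<in> extensional S" by (rule embeddingsD)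
      then show "restrict (f(?x := y)) S = f" for y
        using assms(6) by (auto simp: fun_eq_iff restrict_def extensional_def)
    qed
    show "\<forall>g\<in>embeddings E v (insert ?x S). (\<lambda>(f, y). f(?x := y)) (restrict g S, g ?x) = g"
    proof
      fix g assume "g \<in> embeddings E v (insert ?x S)"
      then have "g \<in> extensional (insert ?x S)" by (rule embeddingsD)
      then show "(\<lambda>(f, y). f(?x := y)) (restrict g S, g ?x) = g"
        by (auto simp: fun_eq_iff restrict_def extensional_def)
    qed
    show "(\<lambda>(f, y). f(?x := y)) ` ?P \<subseteq> embeddings E v (insert ?x S)"
    proof (rule image_subsetI, clarify)
      fix f y assume f: "f \<in> embeddings E v S" and y: "{f q, y} \<in> E" "y \<notin> f ` S"
      note fD = embeddingsD[OF f]
      let ?g = "f(?x := y)"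
      have on: "?g p = f p" if "p \<in> S" for p using that assms(6) by auto
      show "?g \<in> embeddings E v (insert ?x S)"
        unfolding embeddings_def
      proof (intro CollectI conjI allI impI)
        show "?g \<in> extensional (insert ?x S)" using fD(4) by (auto simp: extensional_def)
        show "?g [] = v" using fD(1) by simp
        show "inj_on ?g (insert ?x S)"
          using fD(2) y(2) assms(6) by (auto simp: inj_on_def)
        show "{?g p, ?g (p @ [j])} \<in> E" if "p @ [j] \<in> insert ?x S" for p j
        proof (cases "p @ [j] = ?x")
          case True
          then show ?thesis using y(1) assms(5,6) by auto
        next
          case False
          then have "p @ [j] \<in> S" using that by auto
          then show ?thesis using fD(3) on closed by metis
        qed
      qed
    qed
    show "(\<lambda>g. (restrict g S, g ?x)) ` embeddings E v (insert ?x S) \<subseteq> ?P"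
    proof (rule image_subsetI)
      fix g assume g: "g \<in> embeddings E v (insert ?x S)"
      note gD = embeddingsD[OF g]
      have "restrict g S \<in> embeddings E v S"
        unfolding embeddings_def using gD closed assms(4) by (auto simp: inj_on_def)
      moreover have "{g q, g ?x} \<in> E" using gD(3)[of q i] by simp
      moreover have "g ?x \<notin> g ` S" using gD(2) assms(6) by (auto simp: inj_on_def)
      ultimately show "(restrict g S, g ?x) \<in> ?P" using assms(5) by auto
    qed
  qed
  then have "card (embeddings E v (insert ?x S)) = card ?P" by (simp add: bij_betw_same_card)
  also have "\<dots> = (\<Sum>f\<in>embeddings E v S. card ({y. {f q, y} \<in> E} - f ` S))"
    using finite_embeddings[OF assms(1-3)] finite_neighbours[OF assms(1)] by simp
  finally show ?thesis .
qed

text \<open>Adding the vertices one leaf at a time leaves between \<open>d - m\<close> and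
  \<open>d\<close> choices for each. The assumptions ask for closure under parents instead of
  \<open>plane_tree\<close>, because removing a leaf in the induction may leave a gap among its
  siblings.\<close>

lemma card_embeddings:
  assumes G: "simple_graph V E" "regular d V E" "v \<in> V"
    and S: "finite S" "[] \<in> S" "\<And>p j. p @ [j] \<in> S \<Longrightarrow> p \<in> S" and "card S \<le> m"
  shows "card (embeddings E v S) \<le> d ^ (card S - 1) \<and> (d - m) ^ (card S - 1) \<le> card (embeddings E v S)"
  using S \<open>card S \<le> m\<close>
proof (induction "card S" arbitrary: S rule: less_induct)
  case less
  show ?case
  proof (cases "S = {[]}")
    case True
    have "embeddings E v {[]} = {\<lambda>x\<in>{[]}. v}"
      by (auto simp: embeddings_def extensional_def)
    then show ?thesis using True by simp
  next
    case False
    have "length ` S \<noteq> {}" "finite (length ` S)" using less.prems by auto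
    \<comment> \<open>A vertex of maximal depth has no children, so removing it keeps the set closed
      under parents.\<close>
    then obtain x where x: "x \<in> S" "length x = Max (length ` S)" by (metis Max_in imageE)
    have max: "length y \<le> length x" if "y \<in> S" for y using that less.prems(1) x(2) by simp
    obtain y where "y \<in> S" "y \<noteq> []" using False less.prems(2) by auto
    then have "x \<noteq> []" using max[of y] by auto
    then obtain q i where xq: "x = q @ [i]" by (cases x rule: rev_cases) auto
    let ?S = "S - {x}"
    have ins: "S = insert (q @ [i]) ?S" using x xq by auto
    have cS: "card S = Suc (card ?S)" using x less.prems(1) by (metis card.remove)
    have nil: "[] \<in> ?S" using less.prems(2) \<open>x \<noteq> []\<close> by simp
    have pos: "card ?S \<noteq> 0" using nil less.prems(1) by auto
    have closed: "p \<in> ?S" if "p @ [j] \<in> ?S" for p j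
      using less.prems(3) that max[of "p @ [j]"] by auto
    have q: "q \<in> ?S" using less.prems(3) x xq by auto
    have IH: "card (embeddings E v ?S) \<le> d ^ (card ?S - 1) \<and> (d - m) ^ (card ?S - 1) \<le> card (embeddings E v ?S)"
    proof (rule less.hyps)
      show "card ?S < card S" using cS by linarith
      show "card ?S \<le> m" using cS less.prems(4) by linarith
      show "finite ?S" using less.prems(1) by simp
    qed (fact nil closed)+
    have eq: "card (embeddings E v S) = (\<Sum>f\<in>embeddings E v ?S. card ({y. {f q, y} \<in> E} - f ` ?S))"
    proof -
      have "card (embeddings E v S) = card (embeddings E v (insert (q @ [i]) ?S))" by (subst ins) (rule refl)
      also have "\<dots> = (\<Sum>f\<in>embeddings E v ?S. card ({y. {f q, y} \<in> E} - f ` ?S))"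
        by (rule card_embeddings_insert[OF G(1,3) _ nil q _ closed]) (use less.prems(1) xq in simp_all)
      finally show ?thesis .
    qed
    have bound: "d - m \<le> card ({y. {f q, y} \<in> E} - f ` ?S) \<and> card ({y. {f q, y} \<in> E} - f ` ?S) \<le> d"
      if "f \<in> embeddings E v ?S" for f
    proof -
      have "f q \<in> V" using embeddings_image[OF that G(1,3)] q by auto
      then have c: "card {y. {f q, y} \<in> E} = d" by (rule regular_card_neighbours[OF G(1,2)])
      have "card (f ` ?S) \<le> m"
        using card_image_le[of ?S f] less.prems(1,4) cS by simp
      then have "d - m \<le> d - card (f ` ?S)" by simp
      also have "\<dots> \<le> card ({y. {f q, y} \<in> E} - f ` ?S)"
        unfolding c[symmetric] using less.prems(1) by (intro diff_card_le_card_Diff) auto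
      finally show ?thesis
        using card_mono[OF finite_neighbours[OF G(1)], of "{y. {f q, y} \<in> E} - f ` ?S"] c by auto
    qed
    have n: "card S - 1 = Suc (card ?S - 1)" using cS pos by simp
    have "card (embeddings E v S) \<le> card (embeddings E v ?S) * d"
      unfolding eq using sum_bounded_above[of "embeddings E v ?S" _ d] bound by simp
    also have "\<dots> \<le> d ^ (card ?S - 1) * d" using IH by simp
    finally have 1: "card (embeddings E v S) \<le> d ^ (card S - 1)" unfolding n by (simp add: mult.commute)
    have "(d - m) ^ (card S - 1) = (d - m) ^ (card ?S - 1) * (d - m)" unfolding n by simp
    also have "\<dots> \<le> card (embeddings E v ?S) * (d - m)" using IH by simp
    also have "\<dots> \<le> card (embeddings E v S)"
      unfolding eq using sum_bounded_below[of "embeddings E v ?S" "d - m"] bound by simp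
    finally show ?thesis using 1 by simp
  qed
qed

section \<open>First and second moments\<close>

lemma sum_nchild:
  assumes "plane_tree r S"
  shows "(\<Sum>q\<in>S. nchild S q) = card S - 1"
proof -
  let ?P = "SIGMA q:S. {..<nchild S q}"
  have "bij_betw (\<lambda>(q, i). q @ [i]) ?P (S - {[]})"
  proof (rule bij_betw_imageI)
    show "inj_on (\<lambda>(q, i). q @ [i]) ?P" by (auto simp: inj_on_def)
    show "(\<lambda>(q, i). q @ [i]) ` ?P = S - {[]}"
    proof (intro equalityI subsetI)
      fix x assume x: "x \<in> S - {[]}"
      then obtain q i where "x = q @ [i]" by (cases x rule: rev_cases) auto
      then have "x = (\<lambda>(q, i). q @ [i]) (q, i)" "(q, i) \<in> ?P"
        using x plane_treeD(3)[OF assms] less_nchild_iff[OF assms] by auto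
      then show "x \<in> (\<lambda>(q, i). q @ [i]) ` ?P" by (rule image_eqI)
    qed (use less_nchild_iff[OF assms] in auto)
  qed
  then have "card ?P = card (S - {[]})" by (rule bij_betw_same_card)
  then show ?thesis using plane_treeD(1,2)[OF assms] by simp
qed

text \<open>The offspring numbers add up to \<open>card S - 1\<close>. Vertices of depth
  \<open>r\<close> have no children and contribute only factors \<open>fact 0\<close> to
  \<open>orderings S\<close>, whereas \<open>exp (- c)\<close> occurs once for each vertex of
  smaller depth.\<close>

lemma gw_weight_eq:
  assumes "plane_tree r S" "c > 0"
  shows "gw_weight c r S = c ^ (card S - 1) * exp (- c) ^ card {q \<in> S. length q < r} / real (orderings S)"
proof -
  let ?I = "{q \<in> S. length q < r}"
  have fin: "finite S" by (rule plane_treeD[OF assms(1)])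
  have zero: "nchild S q = 0" if "q \<in> S - ?I" for q
    using that by (intro nchild_full_depth[OF assms(1)]) auto
  have 1: "(\<Sum>q\<in>?I. nchild S q) = card S - 1"
    unfolding sum_nchild[OF assms(1), symmetric] using fin zero by (intro sum.mono_neutral_left) auto
  have 2: "(\<Prod>q\<in>?I. fact (nchild S q)) = orderings S"
    unfolding orderings_def using fin zero by (intro prod.mono_neutral_left) auto
  have "gw_weight c r S = (\<Prod>q\<in>?I. c ^ nchild S q / fact (nchild S q) * exp (- c))"
    unfolding gw_weight_def using assms(2) by simp
  also have "\<dots> = (\<Prod>q\<in>?I. c ^ nchild S q) / (\<Prod>q\<in>?I. fact (nchild S q)) * exp (- c) ^ card ?I"
    by (simp add: prod.distrib prod_dividef)
  also have "(\<Prod>q\<in>?I. c ^ nchild S q) = c ^ (card S - 1)"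
    unfolding 1[symmetric] by (simp add: power_sum)
  also have "(\<Prod>q\<in>?I. fact (nchild S q)) = real (orderings S)"
    unfolding 2[symmetric] by simp
  finally show ?thesis by simp
qed

lemma gw_weight_nonneg: "0 \<le> gw_weight c r S" and gw_weight_le_1: "gw_weight c r S \<le> 1"
  unfolding gw_weight_def by (auto intro: prod_nonneg prod_le_1 simp: pmf_le_1)

text \<open>Every vertex except the root owns the edge to its parent. Two vertices could share an
  edge only by being each other's parent, which their lengths exclude.\<close>

lemma card_open_edges:
  assumes S: "plane_tree r S" and f: "inj_on f S"
  shows "card (open_edges f S) = card S - 1"
proof -
  have "open_edges f S = (\<lambda>q. {f (butlast q), f q}) ` (S - {[]})"
  proof (intro equalityI subsetI)
    fix e assume "e \<in> open_edges f S"
    then obtain q i where q: "q @ [i] \<in> S" "e = {f q, f (q @ [i])}" by (auto simp: open_edges_def)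
    then show "e \<in> (\<lambda>q. {f (butlast q), f q}) ` (S - {[]})" by (intro image_eqI[of _ _ "q @ [i]"]) auto
  next
    fix e assume "e \<in> (\<lambda>q. {f (butlast q), f q}) ` (S - {[]})"
    then obtain x where x: "x \<in> S" "x \<noteq> []" "e = {f (butlast x), f x}" by auto
    then have "butlast x @ [last x] = x" by simp
    then show "e \<in> open_edges f S" using x unfolding open_edges_def
      by (intro CollectI exI[of _ "butlast x"] exI[of _ "last x"]) simp
  qed
  moreover have "inj_on (\<lambda>q. {f (butlast q), f q}) (S - {[]})"
  proof (rule inj_onI)
    fix x y assume x: "x \<in> S - {[]}" and y: "y \<in> S - {[]}"
      and eq: "{f (butlast x), f x} = {f (butlast y), f y}"
    have bl: "butlast z \<in> S" if "z \<in> S - {[]}" for z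
      using that plane_treeD(3)[OF S, of "butlast z" "last z"] by simp
    show "x = y"
    proof (cases "f x = f y")
      case True
      then show ?thesis using f x y by (meson DiffD1 inj_onD)
    next
      case False
      then have "f x = f (butlast y)" "f (butlast x) = f y" using eq by (auto simp: doubleton_eq_iff)
      then have "x = butlast y" "butlast x = y"
        using f x y bl[OF x] bl[OF y] by (meson DiffD1 inj_onD)+
      then have "length x = length x - 1 - 1" by (metis length_butlast)
      moreover have "length x > 0" using x by simp
      ultimately show ?thesis by linarith
    qed
  qed
  ultimately have "card (open_edges f S) = card (S - {[]})" by (simp add: card_image)
  then show ?thesis using plane_treeD(1,2)[OF S] by simp
qed

lemma open_edges_subset: "f \<in> embeddings E v S \<Longrightarrow> open_edges f S \<subseteq> E"
  using embeddingsD(3) by (auto simp: open_edges_def)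

text \<open>Serves to show that maps with disjoint images have disjoint sets of open edges;
  \<open>{}\<close> is removed because the power sets of disjoint images still share it.\<close>

lemma open_edges_Pow: "plane_tree r S \<Longrightarrow> open_edges f S \<subseteq> Pow (f ` S) - {{}}"
  using plane_treeD(3) by (fastforce simp: open_edges_def)

lemma closed_edges_subset: "closed_edges E r f S \<subseteq> E"
  by (auto simp: closed_edges_def)

lemma card_closed_edges_le:
  assumes G: "simple_graph V E" "regular d V E" "v \<in> V" and S: "plane_tree r S"
    and f: "f \<in> embeddings E v S"
  shows "card (closed_edges E r f S) \<le> card {q \<in> S. length q < r} * d + (card S)\<^sup>2"
proof -
  let ?I = "{q \<in> S. length q < r}"
  let ?A = "\<Union>q\<in>?I. {e \<in> E. f q \<in> e}" and ?B = "(\<lambda>(x, y). {x, y}) ` (f ` S \<times> f ` S)"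
  have fin: "finite S" by (rule plane_treeD[OF S])
  have sub: "closed_edges E r f S \<subseteq> ?A \<union> ?B"
  proof
    fix e assume e: "e \<in> closed_edges E r f S"
    then obtain x y where "e = {x, y}"
      using simple_graph_edgeE[OF G(1)] unfolding closed_edges_def by blast
    then show "e \<in> ?A \<union> ?B" using e by (auto simp: closed_edges_def)
  qed
  have "card (closed_edges E r f S) \<le> card (?A \<union> ?B)"
    using sub fin simple_graphD(6)[OF G(1)] by (intro card_mono) auto
  also have "\<dots> \<le> card ?A + card ?B" by (rule card_Un_le)
  also have "card ?A \<le> (\<Sum>q\<in>?I. card {e \<in> E. f q \<in> e})" using fin by (intro card_UN_le) auto
  also have "\<dots> = (\<Sum>q\<in>?I. d)"
    using embeddings_image[OF f G(1,3)] G(2) by (intro sum.cong) (auto simp: regular_def)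
  also have "card ?B \<le> card (f ` S \<times> f ` S)" using fin by (intro card_image_le) auto
  also have "\<dots> = card (f ` S) * card (f ` S)" by (rule card_cartesian_product)
  also have "\<dots> \<le> card S * card S" using fin by (intro mult_le_mono card_image_le)
  finally show ?thesis by (simp add: power2_eq_square)
qed

text \<open>The fraction of the orderings of the ball of radius \<open>r\<close> around \<open>v\<close> that turn it into \<open>S\<close>.\<close>
definition ball_weight :: "'v set set \<Rightarrow> nat \<Rightarrow> nat list set \<Rightarrow> 'v set set \<Rightarrow> 'v \<Rightarrow> real" where
  "ball_weight E r S E' v = real (card (ball_maps E r v S E')) / real (orderings S)"

definition spanned :: "'v set set \<Rightarrow> nat \<Rightarrow> nat list set \<Rightarrow> (nat list \<Rightarrow> 'v) \<Rightarrow> 'v set set set" where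
  "spanned E r S f = {E'. open_edges f S \<subseteq> E' \<and> closed_edges E r f S \<inter> E' = {}}"

lemma ball_maps_spanned: "ball_maps E r v S E' = {f \<in> embeddings E v S. E' \<in> spanned E r S f}"
  unfolding ball_maps_def spanned_def by auto

lemma prob_spanned:
  assumes G: "simple_graph V E" and f: "f \<in> embeddings E v S" and S: "plane_tree r S" and p: "0 \<le> p" "p \<le> 1"
  shows "measure_pmf.prob (random_subgraph E p) (spanned E r S f) =
    p ^ (card S - 1) * (1 - p) ^ card (closed_edges E r f S)"
  unfolding spanned_def
  by (subst random_subgraph_cylinder[OF simple_graphD(6)[OF G] open_edges_subset[OF f] closed_edges_subset _ p])
     (auto simp: closed_edges_def card_open_edges[OF S embeddingsD(2)[OF f]])

lemma expectation_ball_weight: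
  assumes G: "simple_graph V E" "v \<in> V" and S: "finite S"
  shows "measure_pmf.expectation (random_subgraph E p) (\<lambda>E'. ball_weight E r S E' v) =
    (\<Sum>f\<in>embeddings E v S. measure_pmf.prob (random_subgraph E p) (spanned E r S f)) / real (orderings S)"
proof -
  have fin: "finite (embeddings E v S)" by (rule finite_embeddings[OF G S])
  have "ball_weight E r S E' v = (\<Sum>f\<in>embeddings E v S. indicator (spanned E r S f) E') / real (orderings S)" for E'
    unfolding ball_weight_def ball_maps_spanned using fin
    by (simp add: indicator_def sum.If_cases Int_def)
  then show ?thesis by (simp add: Bochner_Integration.integral_sum less_top[symmetric])
qed

text \<open>With \<open>p = c / d \<le> 1/2\<close>, the bound
  \<open>ln (1 - p) \<ge> - p - 2 * p\<^sup>2\<close> is multiplied by the exponent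
  \<open>i * d + m\<^sup>2\<close>. The main term is \<open>i * c\<close>; the rest is at most
  \<open>2 * c * p * m\<^sup>2 + 2 * p * m\<^sup>2\<close>, by \<open>i \<le> m\<^sup>2\<close> and
  \<open>1 + 2 * p \<le> 2\<close>, and this gives \<open>2 * (c + c\<^sup>2)\<close>.\<close>

lemma power_one_minus_ge:
  fixes c :: real
  assumes "0 < c" "2 * c \<le> real d" "i \<le> m"
  shows "exp (- c) ^ i * (1 - 2 * (c + c\<^sup>2) * (real m)\<^sup>2 / real d) \<le> (1 - c / real d) ^ (i * d + m\<^sup>2)"
proof -
  define p where "p = c / real d"
  let ?N = "real (i * d + m\<^sup>2)"
  have d: "real d > 0" using assms by simp
  have p: "0 \<le> p" "p \<le> 1/2" using assms d by (auto simp: p_def field_simps)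
  have im: "real i \<le> (real m)\<^sup>2"
  proof -
    have "i \<le> m\<^sup>2" using assms(3) le_square[of m] unfolding power2_eq_square by linarith
    then show ?thesis by (metis of_nat_le_iff of_nat_power)
  qed
  have pd: "p * real d = c" using d by (simp add: p_def)
  have "?N * (p + 2 * p\<^sup>2) = real i * (p * real d) * (1 + 2 * p) + (real m)\<^sup>2 * p * (1 + 2 * p)"
    by (simp add: algebra_simps power2_eq_square)
  also have "\<dots> = real i * c + real i * (2 * c * p) + (real m)\<^sup>2 * p * (1 + 2 * p)"
    unfolding pd by (simp add: algebra_simps)
  also have "\<dots> \<le> real i * c + (real m)\<^sup>2 * (2 * c * p) + (real m)\<^sup>2 * p * 2"
    using p im assms(1) by (intro add_mono mult_right_mono mult_left_mono) auto
  also have "\<dots> = real i * c + 2 * (c + c\<^sup>2) * (real m)\<^sup>2 / real d"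
    unfolding p_def by (simp add: add_divide_distrib power2_eq_square algebra_simps)
  finally have N: "?N * (p + 2 * p\<^sup>2) \<le> real i * c + 2 * (c + c\<^sup>2) * (real m)\<^sup>2 / real d" (is "_ \<le> _ + ?y") .
  have "exp (- c) ^ i * (1 - ?y) \<le> exp (- c) ^ i * exp (- ?y)"
    using exp_ge_add_one_self[of "- ?y"] by (intro mult_left_mono) auto
  also have "\<dots> = exp (- (real i * c + ?y))"
    by (simp add: exp_of_nat_mult[symmetric] exp_add[symmetric])
  also have "\<dots> \<le> exp (?N * (- p - 2 * p\<^sup>2))" using N by (simp add: algebra_simps)
  also have "\<dots> \<le> exp (?N * ln (1 - p))"
    using ln_one_minus_pos_lower_bound[OF p] by (simp add: mult_left_mono)
  also have "\<dots> = (1 - p) ^ (i * d + m\<^sup>2)"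
    using p by (subst exp_of_nat_mult) simp
  finally show ?thesis unfolding p_def .
qed

text \<open>Two relative losses add up: \<open>m\<^sup>2 / d\<close> for the number of embeddings,
  by Bernoulli applied to \<open>(1 - m / d) ^ (card S - 1)\<close>, and
  \<open>2 * (c + c\<^sup>2) * m\<^sup>2 / d\<close> for the probability of each.
  \<open>small\<close> makes their sum at most 1, so the factors may be multiplied.\<close>

lemma expectation_ball_weight_ge:
  assumes G: "simple_graph V E" "regular d V E" "v \<in> V" and S: "plane_tree r S"
    and c: "0 < c" "2 * c \<le> real d" and m: "card S \<le> m" "m \<le> d"
    and small: "(1 + 2 * c + 2 * c\<^sup>2) * (real m)\<^sup>2 \<le> real d"
  shows "gw_weight c r S * (1 - (1 + 2 * c + 2 * c\<^sup>2) * (real m)\<^sup>2 / real d) \<le>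
    measure_pmf.expectation (random_subgraph E (c / real d)) (\<lambda>E'. ball_weight E r S E' v)"
proof -
  let ?s = "card S - 1" and ?i = "card {q \<in> S. length q < r}" and ?p = "c / real d"
  let ?M = "random_subgraph E ?p"
  have fin: "finite S" by (rule plane_treeD[OF S])
  have i: "?i \<le> m" using card_mono[OF fin, of "{q \<in> S. length q < r}"] m(1) by auto
  have d: "real d > 0" using c by simp
  have p: "0 \<le> ?p" "?p \<le> 1" using c d by (auto simp: field_simps)
  let ?a = "(real m)\<^sup>2 / real d" and ?b = "2 * (c + c\<^sup>2) * (real m)\<^sup>2 / real d"
  have ab: "?a + ?b = (1 + 2 * c + 2 * c\<^sup>2) * (real m)\<^sup>2 / real d"
    by (simp add: add_divide_distrib[symmetric] algebra_simps)
  have ab1: "?a + ?b \<le> 1" unfolding ab using small d by (simp add: field_simps)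
  have nn: "0 \<le> ?a" "0 \<le> ?b" using c by auto
  have cnt: "real d ^ ?s * (1 - ?a) \<le> real (card (embeddings E v S))"
  proof -
    have "1 - ?a \<le> 1 + real ?s * (- (real m / real d))"
    proof -
      have "real ?s * real m \<le> real m * real m" using m(1) by (intro mult_right_mono) auto
      then show ?thesis using d by (simp add: field_simps power2_eq_square)
    qed
    also have "\<dots> \<le> (1 + (- (real m / real d))) ^ ?s"
      using m(2) d by (intro Bernoulli_inequality) (simp add: field_simps)
    finally have "real d ^ ?s * (1 - ?a) \<le> real d ^ ?s * (1 - real m / real d) ^ ?s"
      using d by (intro mult_left_mono) auto
    also have "\<dots> = (real d - real m) ^ ?s"
      unfolding power_mult_distrib[symmetric] using d by (simp add: algebra_simps)
    also have "\<dots> = real ((d - m) ^ ?s)" using m(2) by (simp add: of_nat_diff)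
    also have "\<dots> \<le> real (card (embeddings E v S))"
      using card_embeddings[OF G fin plane_treeD(2)[OF S] plane_treeD(3)[OF S] m(1)] by (simp only: of_nat_le_iff)
    finally show ?thesis .
  qed
  have prob: "?p ^ ?s * (exp (- c) ^ ?i * (1 - ?b)) \<le> measure_pmf.prob ?M (spanned E r S f)"
    if f: "f \<in> embeddings E v S" for f
  proof -
    have "exp (- c) ^ ?i * (1 - ?b) \<le> (1 - ?p) ^ (?i * d + m\<^sup>2)"
      using power_one_minus_ge[OF c i] .
    also have "\<dots> \<le> (1 - ?p) ^ card (closed_edges E r f S)"
    proof (rule power_decreasing)
      have "(card S)\<^sup>2 \<le> m\<^sup>2" using m(1) by (rule power_mono) simp
      then show "card (closed_edges E r f S) \<le> ?i * d + m\<^sup>2"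
        using card_closed_edges_le[OF G S f] by linarith
    qed (use p in auto)
    finally show ?thesis
      unfolding prob_spanned[OF G(1) f S p] using p by (intro mult_left_mono) auto
  qed
  have "(1 - (?a + ?b)) \<le> (1 - ?a) * (1 - ?b)" 
  proof -
    have "(1 - x) * (1 - y) = 1 - (x + y) + x * y" for x y :: real by (simp add: algebra_simps)
    then show ?thesis using mult_nonneg_nonneg[OF nn] by simp
  qed
  then have "gw_weight c r S * (1 - (?a + ?b)) \<le> gw_weight c r S * ((1 - ?a) * (1 - ?b))"
    using gw_weight_nonneg by (intro mult_left_mono) auto
  also have "\<dots> = (real d ^ ?s * (1 - ?a)) * (?p ^ ?s * (exp (- c) ^ ?i * (1 - ?b))) / real (orderings S)"
    unfolding gw_weight_eq[OF S c(1)] using d by (simp add: power_divide)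
  also have "\<dots> \<le> real (card (embeddings E v S)) * (?p ^ ?s * (exp (- c) ^ ?i * (1 - ?b))) / real (orderings S)"
  proof (intro divide_right_mono mult_right_mono mult_nonneg_nonneg zero_le_power)
    show "0 \<le> 1 - ?b" using nn ab1 by linarith
  qed (use cnt p in auto)
  also have "\<dots> = (\<Sum>f\<in>embeddings E v S. ?p ^ ?s * (exp (- c) ^ ?i * (1 - ?b))) / real (orderings S)"
    by simp
  also have "\<dots> \<le> (\<Sum>f\<in>embeddings E v S. measure_pmf.prob ?M (spanned E r S f)) / real (orderings S)"
    using prob by (intro divide_right_mono sum_mono) auto
  finally show ?thesis unfolding expectation_ball_weight[OF G(1,3) fin] ab .
qed

text \<open>An upper bound needs many closed edges. The \<open>2 * i\<close> interior vertices of
  the two images meet at least \<open>2 * i * (d - 2 * i)\<close> edges, and at most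
  \<open>2 * (card S - 1)\<close> of these are open; so at most \<open>6 * m\<^sup>2\<close> factors
  \<open>1 - p\<close> are missing from \<open>(1 - p) ^ (2 * i * d)\<close>, which is at most
  \<open>exp (- c) ^ (2 * i)\<close>.\<close>

lemma prob_spanned_pair_le:
  assumes G: "simple_graph V E" "regular d V E" "v \<in> V" "w \<in> V" and S: "plane_tree r S"
    and f: "f \<in> embeddings E v S" and g: "g \<in> embeddings E w S" and disj: "f ` S \<inter> g ` S = {}"
    and c: "0 < c" "c \<le> real d" and m: "card S \<le> m" and small: "6 * c * (real m)\<^sup>2 < real d"
  shows "measure_pmf.prob (random_subgraph E (c / real d)) (spanned E r S f \<inter> spanned E r S g) \<le>
    ((c / real d) ^ (card S - 1) * exp (- c) ^ card {q \<in> S. length q < r})\<^sup>2 / (1 - 6 * c * (real m)\<^sup>2 / real d)"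
proof -
  let ?s = "card S - 1" and ?i = "card {q \<in> S. length q < r}" and ?p = "c / real d"
  let ?M = "random_subgraph E ?p"
  let ?A = "open_edges f S \<union> open_edges g S" and ?B = "closed_edges E r f S \<union> closed_edges E r g S"
  have fin: "finite S" by (rule plane_treeD[OF S])
  have i: "?i \<le> m" using card_mono[OF fin, of "{q \<in> S. length q < r}"] m(1) by auto
  have d: "real d > 0" using c by simp
  have p: "0 \<le> ?p" "?p \<le> 1" using c d by (auto simp: field_simps)
  have finE: "finite E" by (rule simple_graphD[OF G(1)])
  have den: "0 < 1 - 6 * c * (real m)\<^sup>2 / real d" using small d by (simp add: field_simps)
  have ev: "spanned E r S f \<inter> spanned E r S g = {E'. ?A \<subseteq> E' \<and> ?B \<inter> E' = {}}"
    by (auto simp: spanned_def)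
  have AE: "?A \<subseteq> E" using open_edges_subset[OF f] open_edges_subset[OF g] by blast
  have BE: "?B \<subseteq> E" using closed_edges_subset[of E r f S] closed_edges_subset[of E r g S] by blast
  show ?thesis
  proof (cases "?A \<inter> ?B = {}")
    \<comment> \<open>An edge that one map wants open and the other wants closed makes the joint
      event empty.\<close>
    case False
    then have "{E'. ?A \<subseteq> E' \<and> ?B \<inter> E' = {}} = {}" by blast
    then have "measure_pmf.prob ?M (spanned E r S f \<inter> spanned E r S g) = 0"
      unfolding ev by (simp only: measure_empty)
    then show ?thesis using den by simp
  next
    case True
    have "open_edges f S \<inter> open_edges g S = {}"
      using open_edges_Pow[OF S, of f] open_edges_Pow[OF S, of g] disj by blast
    then have cA: "card ?A = ?s + ?s"
      using card_open_edges[OF S embeddingsD(2)[OF f]] card_open_edges[OF S embeddingsD(2)[OF g]]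
        AE finE by (subst card_Un_disjoint) (auto intro: finite_subset)
    let ?I = "{q \<in> S. length q < r}"
    let ?U = "f ` ?I \<union> g ` ?I"
    have inj: "inj_on f ?I" "inj_on g ?I"
      using embeddingsD(2)[OF f] embeddingsD(2)[OF g] by (auto intro: inj_on_subset)
    have cU: "card ?U = 2 * ?i"
      using fin disj inj by (subst card_Un_disjoint) (auto simp: card_image)
    have UV: "?U \<subseteq> V" using embeddings_image[OF f G(1,3)] embeddings_image[OF g G(1,4)] by auto
    \<comment> \<open>Every edge at an interior vertex is prescribed: it is open or closed for the
      map whose image contains that vertex.\<close>
    have "{e \<in> E. \<exists>u\<in>?U. u \<in> e} \<subseteq> ?A \<union> ?B" unfolding closed_edges_def by auto
    then have "card {e \<in> E. \<exists>u\<in>?U. u \<in> e} \<le> card (?A \<union> ?B)"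
      using AE BE finE by (intro card_mono) (auto intro: finite_subset)
    also have "\<dots> \<le> card ?A + card ?B" by (rule card_Un_le)
    finally have "2 * ?i * (d - 2 * ?i) \<le> 2 * ?s + card ?B"
      using card_incident_ge[OF G(1,2) UV] cA unfolding cU by simp
    moreover have "2 * ?i * d \<le> 2 * ?i * (d - 2 * ?i) + 2 * ?i * (2 * ?i)"
      unfolding add_mult_distrib2[symmetric] by (rule mult_le_mono2) simp
    \<comment> \<open>The constant 6 is 4 from edges with both ends among the interior vertices plus
      2 from the open edges.\<close>
    moreover have "2 * ?i * (2 * ?i) \<le> 2 * m * (2 * m)" using i by (intro mult_le_mono) auto
    moreover have "2 * ?s \<le> 2 * (m * m)" using m by (metis diff_le_self le_square le_trans mult_le_mono2)
    ultimately have B: "2 * ?i * d \<le> card ?B + 6 * m\<^sup>2" by (simp add: power2_eq_square)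
    have "(1 - ?p) ^ card ?B * (1 - 6 * c * (real m)\<^sup>2 / real d) \<le> (1 - ?p) ^ card ?B * (1 - ?p) ^ (6 * m\<^sup>2)"
      using Bernoulli_inequality[of "- ?p" "6 * m\<^sup>2"] p
      by (intro mult_left_mono) (auto simp: algebra_simps)
    also have "\<dots> = (1 - ?p) ^ (card ?B + 6 * m\<^sup>2)" by (simp add: power_add)
    also have "\<dots> \<le> (1 - ?p) ^ (2 * ?i * d)" using B p by (intro power_decreasing) auto
    also have "\<dots> \<le> exp (- ?p) ^ (2 * ?i * d)"
      using p exp_ge_add_one_self[of "- ?p"] by (intro power_mono) auto
    also have "\<dots> = (exp (- ?p) ^ d) ^ (?i * 2)" by (simp add: power_mult[symmetric] mult.commute)
    also have "exp (- ?p) ^ d = exp (- c)"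
      using d by (simp add: exp_of_nat_mult[symmetric])
    also have "exp (- c) ^ (?i * 2) = (exp (- c) ^ ?i)\<^sup>2" by (rule power_mult)
    finally have Bp: "(1 - ?p) ^ card ?B \<le> (exp (- c) ^ ?i)\<^sup>2 / (1 - 6 * c * (real m)\<^sup>2 / real d)"
      using den by (simp add: pos_le_divide_eq)
    have "measure_pmf.prob ?M (spanned E r S f \<inter> spanned E r S g) = ?p ^ card ?A * (1 - ?p) ^ card ?B"
      unfolding ev by (rule random_subgraph_cylinder[OF finE AE BE True p])
    also have "\<dots> \<le> ?p ^ card ?A * ((exp (- c) ^ ?i)\<^sup>2 / (1 - 6 * c * (real m)\<^sup>2 / real d))"
      using Bp p by (intro mult_left_mono) auto
    also have "?p ^ card ?A = (?p ^ ?s)\<^sup>2" unfolding cA by (simp add: power_add power2_eq_square)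
    finally show ?thesis by (simp add: power_mult_distrib)
  qed
qed

section \<open>Pairs of roots and the second moment\<close>

lemma dist_le_Cons: "{v, y} \<in> E \<Longrightarrow> dist_le E j y w \<Longrightarrow> dist_le E (Suc j) v w"
proof (induction j arbitrary: w)
  case (Suc j)
  show ?case
  proof (cases "dist_le E j y w")
    case True
    then show ?thesis using Suc.IH[OF Suc.prems(1)] dist_le_mono[of E "Suc j" v w "Suc (Suc j)"] by simp
  next
    case False
    then obtain u where "dist_le E j y u" "{u, w} \<in> E" using Suc.prems(2) by auto
    then show ?thesis using Suc.IH[OF Suc.prems(1), of u] by (metis dist_le.simps(2))
  qed
qed auto

lemma dist_le_sym: "dist_le E j v w \<Longrightarrow> dist_le E j w v"
proof (induction j arbitrary: w)
  case (Suc j)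
  show ?case
  proof (cases "dist_le E j v w")
    case False
    then obtain u where "dist_le E j v u" "{u, w} \<in> E" using Suc.prems by auto
    then show ?thesis using Suc.IH dist_le_Cons by (metis insert_commute)
  qed (use Suc.IH in auto)
qed auto

lemma dist_le_trans: "dist_le E i u v \<Longrightarrow> dist_le E j v w \<Longrightarrow> dist_le E (i + j) u w"
proof (induction j arbitrary: w)
  case (Suc j)
  show ?case
  proof (cases "dist_le E j v w")
    case True
    then show ?thesis using Suc by simp
  next
    case False
    then obtain x where "dist_le E j v x" "{x, w} \<in> E" using Suc.prems by auto
    then show ?thesis using Suc by auto
  qed
qed auto

lemma ball_weight_nonneg: "0 \<le> ball_weight E r S E' v"
  by (simp add: ball_weight_def)

lemma ball_weight_le_1:
  assumes "simple_graph V E" "v \<in> V" "E' \<subseteq> E" "plane_tree r S"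
  shows "ball_weight E r S E' v \<le> 1"
  using sum_ball_maps_le_1[OF assms(1-3), of "{S}" r] assms(4) by (simp add: ball_weight_def)

text \<open>If the roots are more than \<open>2 * r\<close> apart, the two balls are disjoint, and
  so are the images of any two ball maps. For closer roots, including \<open>v = w\<close>, the
  product of two weights is bounded by 1.\<close>

lemma ball_weight_mult_le:
  assumes G: "simple_graph V E" "v \<in> V" "w \<in> V" and E': "E' \<subseteq> E" and S: "plane_tree r S"
  shows "ball_weight E r S E' v * ball_weight E r S E' w \<le>
    (\<Sum>(f, g)\<in>{(f, g) \<in> embeddings E v S \<times> embeddings E w S. f ` S \<inter> g ` S = {}}.
       indicator (spanned E r S f \<inter> spanned E r S g) E') / (real (orderings S))\<^sup>2
    + indicator {E'. dist_le E' (2 * r) v w} E'" (is "_ \<le> (\<Sum>(f, g)\<in>?P. _) / _ + _")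
proof -
  have fin: "finite S" by (rule plane_treeD[OF S])
  have finP: "finite ?P"
    using finite_embeddings[OF G(1,2) fin] finite_embeddings[OF G(1,3) fin]
    by (auto intro: finite_subset[of _ "embeddings E v S \<times> embeddings E w S"])
  have nn: "0 \<le> (\<Sum>(f, g)\<in>?P. indicator (spanned E r S f \<inter> spanned E r S g) E' :: real)"
    by (intro sum_nonneg) auto
  show ?thesis
  proof (cases "dist_le E' (2 * r) v w")
    case True
    have "ball_weight E r S E' v * ball_weight E r S E' w \<le> 1"
      using ball_weight_le_1[OF G(1,2) E' S] ball_weight_le_1[OF G(1,3) E' S] ball_weight_nonneg
      by (intro mult_le_one) auto
    then show ?thesis using True nn by (simp add: add_increasing)
  next
    case False
    have disj: "f ` S \<inter> g ` S = {}" if f: "f \<in> ball_maps E r v S E'" and g: "g \<in> ball_maps E r w S E'" for f g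
    proof (rule ccontr)
      assume "f ` S \<inter> g ` S \<noteq> {}"
      then obtain q q' where q: "q \<in> S" "q' \<in> S" "f q = g q'" by auto
      have "dist_le E' r v (f q)"
        unfolding ball_map_dist[OF S f E' order.refl] using q plane_treeD(5)[OF S] by auto
      moreover have "dist_le E' r w (f q)"
        unfolding ball_map_dist[OF S g E' order.refl] using q plane_treeD(5)[OF S] by metis
      ultimately have "dist_le E' (r + r) v w" by (intro dist_le_trans[OF _ dist_le_sym])
      then show False using False by (simp add: mult_2)
    qed
    have "ball_maps E r v S E' \<times> ball_maps E r w S E' = {x \<in> ?P. (case x of (f, g) \<Rightarrow> E' \<in> spanned E r S f \<inter> spanned E r S g)}"
      using disj unfolding ball_maps_spanned by auto
    then have "card (ball_maps E r v S E' \<times> ball_maps E r w S E') =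
        (\<Sum>x\<in>?P. if (case x of (f, g) \<Rightarrow> E' \<in> spanned E r S f \<inter> spanned E r S g) then 1 else 0)"
      by (simp only: card_eq_sum sum.inter_filter[OF finP])
    then have "real (card (ball_maps E r v S E') * card (ball_maps E r w S E')) =
        (\<Sum>(f, g)\<in>?P. indicator (spanned E r S f \<inter> spanned E r S g) E')"
      unfolding card_cartesian_product
      by (simp add: indicator_def case_prod_beta of_bool_def if_distrib[of real] cong: if_cong)
    then show ?thesis
      unfolding ball_weight_def by (simp add: power2_eq_square)
  qed
qed

text \<open>At most \<open>d ^ (card S - 1)\<close> embeddings exist at each root, so the powers of
  \<open>d\<close> cancel in the sum over disjoint pairs and the square of
  \<open>gw_weight_eq\<close> remains.\<close>

lemma expectation_ball_weight_mult_le: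
  assumes G: "simple_graph V E" "regular d V E" "v \<in> V" "w \<in> V" and S: "plane_tree r S"
    and c: "0 < c" "c \<le> real d" and m: "card S \<le> m" and small: "6 * c * (real m)\<^sup>2 < real d"
  shows "measure_pmf.expectation (random_subgraph E (c / real d))
      (\<lambda>E'. ball_weight E r S E' v * ball_weight E r S E' w) \<le>
    (gw_weight c r S)\<^sup>2 / (1 - 6 * c * (real m)\<^sup>2 / real d) +
    measure_pmf.prob (random_subgraph E (c / real d)) {E'. dist_le E' (2 * r) v w}"
proof -
  let ?s = "card S - 1" and ?i = "card {q \<in> S. length q < r}" and ?p = "c / real d"
  let ?M = "random_subgraph E ?p"
  let ?P = "{(f, g) \<in> embeddings E v S \<times> embeddings E w S. f ` S \<inter> g ` S = {}}"
  let ?X = "\<lambda>E'. (\<Sum>(f, g)\<in>?P. indicator (spanned E r S f \<inter> spanned E r S g) E') / (real (orderings S))\<^sup>2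
    + indicator {E'. dist_le E' (2 * r) v w} E' :: real"
  let ?D = "1 - 6 * c * (real m)\<^sup>2 / real d"
  let ?q = "?p ^ ?s * exp (- c) ^ ?i"
  have d: "real d > 0" using c by simp
  have den: "0 < ?D" using small d by (simp add: field_simps)
  have fin: "finite S" by (rule plane_treeD[OF S])
  have finM: "finite (set_pmf ?M)" by (rule finite_set_random_subgraph[OF simple_graphD(6)[OF G(1)]])
  have int: "integrable ?M F" for F :: "'a set set \<Rightarrow> real"
    by (rule integrable_measure_pmf_finite[OF finM])
  have "measure_pmf.expectation ?M (\<lambda>E'. ball_weight E r S E' v * ball_weight E r S E' w) \<le> measure_pmf.expectation ?M ?X"
    by (intro integral_mono_AE int)
       (simp only: AE_measure_pmf_iff, intro ballI ball_weight_mult_le[OF G(1,3,4) _ S] set_random_subgraph)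
  also have "\<dots> = (\<Sum>(f, g)\<in>?P. measure_pmf.prob ?M (spanned E r S f \<inter> spanned E r S g)) / (real (orderings S))\<^sup>2
     + measure_pmf.prob ?M {E'. dist_le E' (2 * r) v w}"
    by (simp add: Bochner_Integration.integral_add[OF int int] Bochner_Integration.integral_sum int case_prod_beta)
  also have "(\<Sum>(f, g)\<in>?P. measure_pmf.prob ?M (spanned E r S f \<inter> spanned E r S g)) \<le> (\<Sum>x\<in>?P. ?q\<^sup>2 / ?D)"
    using prob_spanned_pair_le[OF G S _ _ _ c m small] by (intro sum_mono) auto
  also have "\<dots> = real (card ?P) * (?q\<^sup>2 / ?D)" by simp
  also have "\<dots> \<le> (real d ^ ?s)\<^sup>2 * (?q\<^sup>2 / ?D)"
  proof (rule mult_right_mono)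
    have "card ?P \<le> card (embeddings E v S \<times> embeddings E w S)"
      using finite_embeddings[OF G(1,3) fin] finite_embeddings[OF G(1,4) fin] by (intro card_mono) auto
    also have "\<dots> \<le> d ^ ?s * d ^ ?s"
      unfolding card_cartesian_product
      using card_embeddings[OF G(1,2,3) fin plane_treeD(2)[OF S] plane_treeD(3)[OF S] order.refl]
        card_embeddings[OF G(1,2,4) fin plane_treeD(2)[OF S] plane_treeD(3)[OF S] order.refl]
      by (intro mult_le_mono) auto
    finally have "real (card ?P) \<le> real (d ^ ?s * d ^ ?s)" by (simp only: of_nat_le_iff)
    then show "real (card ?P) \<le> (real d ^ ?s)\<^sup>2" by (simp add: power2_eq_square)
    show "0 \<le> ?q\<^sup>2 / ?D" using den by simp
  qed
  also have "\<dots> / (real (orderings S))\<^sup>2 = (gw_weight c r S)\<^sup>2 / ?D"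
    unfolding gw_weight_eq[OF S c(1)] using d by (simp add: power_divide power_mult_distrib)
  finally show ?thesis by (simp add: divide_right_mono)
qed

definition mean_weight :: "'v set \<Rightarrow> 'v set set \<Rightarrow> nat \<Rightarrow> nat list set \<Rightarrow> 'v set set \<Rightarrow> real" where
  "mean_weight V E r S E' = (\<Sum>v\<in>V. ball_weight E r S E' v) / real (card V)"

text \<open>Expanding the square needs an upper bound for the second moment and only a lower bound
  for the first. With relative errors \<open>x\<close> and \<open>y\<close> the terms in
  \<open>g\<^sup>2\<close> cancel down to \<open>g\<^sup>2 * (2 * x + 2 * y)\<close>, where
  \<open>g \<le> 1\<close>; the constant is
  \<open>2 * 6 * c + 2 * (1 + 2 * c + 2 * c\<^sup>2)\<close>. The sum of the \<open>c ^ i\<close>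
  bounds the expected number of vertices within distance \<open>2 * r\<close> of a vertex.\<close>

lemma second_moment_mean_weight:
  assumes G: "simple_graph V E" "regular d V E" "V \<noteq> {}" and S: "plane_tree r S"
    and c: "0 < c" and m: "card S \<le> m" and small: "(2 + 16 * c + 4 * c\<^sup>2) * (real m)\<^sup>2 \<le> real d"
  shows "measure_pmf.expectation (random_subgraph E (c / real d))
      (\<lambda>E'. (mean_weight V E r S E' - gw_weight c r S)\<^sup>2) \<le>
    (2 + 16 * c + 4 * c\<^sup>2 + (\<Sum>i\<le>2 * r. c ^ i)) * (real m)\<^sup>2 / real d"
proof -
  let ?M = "random_subgraph E (c / real d)"
  let ?g = "gw_weight c r S" and ?n = "real (card V)"
  let ?A = "\<Sum>i\<le>2 * r. c ^ i"
  let ?x = "6 * c * (real m)\<^sup>2 / real d" and ?y = "(1 + 2 * c + 2 * c\<^sup>2) * (real m)\<^sup>2 / real d"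
  have fin: "finite S" and finV: "finite V" using plane_treeD[OF S] simple_graphD[OF G(1)] by auto
  have "card S \<noteq> 0" using fin plane_treeD(2)[OF S] by auto
  then have m1: "1 \<le> m" using m by simp
  then have m2: "real m \<le> (real m)\<^sup>2" "1 \<le> (real m)\<^sup>2" 
    using self_le_power[of "real m" 2] one_le_power[of "real m" 2] by auto
  \<comment> \<open>Each bound in \<open>h\<close> arises by dropping nonnegative terms here.
    Together they give \<open>?x \<le> 1/2\<close> and the smallness conditions of both moment
    estimates.\<close>
  have "2 * (real m)\<^sup>2 + 16 * c * (real m)\<^sup>2 + 4 * c\<^sup>2 * (real m)\<^sup>2 \<le> real d"
    using small by (simp add: algebra_simps)
  moreover have nn: "0 \<le> c * (real m)\<^sup>2" "0 \<le> c\<^sup>2 * (real m)\<^sup>2" using c by auto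
  moreover have cm: "c \<le> c * (real m)\<^sup>2" using m2 c by simp
  ultimately have h: "2 * c \<le> real d" "12 * (c * (real m)\<^sup>2) \<le> real d" "real m \<le> real d"
      "(real m)\<^sup>2 + 2 * (c * (real m)\<^sup>2) + 2 * (c\<^sup>2 * (real m)\<^sup>2) \<le> real d"
    using m2 by linarith+
  have d: "real d > 0" using h(1) c by linarith
  have md: "m \<le> d" using h(3) by simp
  have cd: "c \<le> real d" using h(1) c by linarith
  have x: "0 \<le> ?x" "?x \<le> 1/2" using h(2) c d by (auto simp: field_simps)
  have y: "0 \<le> ?y" using c by auto
  have s1: "(1 + 2 * c + 2 * c\<^sup>2) * (real m)\<^sup>2 \<le> real d" using h(4) by (simp add: algebra_simps)
  have s2: "6 * c * (real m)\<^sup>2 < real d" using h(2) nn d by linarith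
  have n: "?n > 0" "real d \<le> ?n"
    using G(3) finV regular_card_vertices[OF G] by (auto simp: card_gt_0_iff)
  have int: "integrable ?M F" for F :: "'a set set \<Rightarrow> real"
    by (intro integrable_measure_pmf_finite finite_set_random_subgraph simple_graphD(6)[OF G(1)])
  have p: "0 \<le> c / real d" "c / real d \<le> 1" using c cd d by auto
  have E1: "?g * (1 - ?y) \<le> measure_pmf.expectation ?M (mean_weight V E r S)"
  proof -
    have "?n * (?g * (1 - ?y)) = (\<Sum>v\<in>V. ?g * (1 - ?y))" by simp
    also have "\<dots> \<le> (\<Sum>v\<in>V. measure_pmf.expectation ?M (\<lambda>E'. ball_weight E r S E' v))"
      by (intro sum_mono expectation_ball_weight_ge[OF G(1,2) _ S c h(1) m md s1])
    also have "\<dots> = ?n * measure_pmf.expectation ?M (mean_weight V E r S)"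
      unfolding mean_weight_def using n by (simp add: Bochner_Integration.integral_sum int)
    finally show ?thesis using n by simp
  qed
  have E2: "measure_pmf.expectation ?M (\<lambda>E'. (mean_weight V E r S E')\<^sup>2) \<le> ?g\<^sup>2 / (1 - ?x) + ?A / ?n"
  proof -
    have "?n\<^sup>2 * measure_pmf.expectation ?M (\<lambda>E'. (mean_weight V E r S E')\<^sup>2) =
       measure_pmf.expectation ?M (\<lambda>E'. \<Sum>v\<in>V. \<Sum>w\<in>V. ball_weight E r S E' v * ball_weight E r S E' w)"
      unfolding mean_weight_def power_divide using n
      by (simp add: power2_eq_square sum_product)
    also have "\<dots> = (\<Sum>v\<in>V. \<Sum>w\<in>V. measure_pmf.expectation ?M (\<lambda>E'. ball_weight E r S E' v * ball_weight E r S E' w))"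
      by (simp add: Bochner_Integration.integral_sum int)
    also have "\<dots> \<le> (\<Sum>v\<in>V. \<Sum>w\<in>V. ?g\<^sup>2 / (1 - ?x) + measure_pmf.prob ?M {E'. dist_le E' (2 * r) v w})"
      by (intro sum_mono expectation_ball_weight_mult_le[OF G(1,2) _ _ S c cd m s2])
    also have "\<dots> = ?n\<^sup>2 * (?g\<^sup>2 / (1 - ?x)) + (\<Sum>v\<in>V. \<Sum>w\<in>V. measure_pmf.prob ?M {E'. dist_le E' (2 * r) v w})"
      by (simp add: sum.distrib power2_eq_square)
    also have "(\<Sum>v\<in>V. \<Sum>w\<in>V. measure_pmf.prob ?M {E'. dist_le E' (2 * r) v w}) \<le> (\<Sum>v\<in>V. ?A)"
    proof (rule sum_mono)
      fix v
      have "real d * (c / real d) = c" using d by simp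
      then show "(\<Sum>w\<in>V. measure_pmf.prob ?M {E'. dist_le E' (2 * r) v w}) \<le> ?A"
        using sum_prob_dist_le[OF G(1) regular_card_neighbours_le[OF G(1,2)] p, of "2 * r" v] by simp
    qed
    also have "?n\<^sup>2 * (?g\<^sup>2 / (1 - ?x)) + (\<Sum>v\<in>V. ?A) = ?n\<^sup>2 * (?g\<^sup>2 / (1 - ?x) + ?A / ?n)"
      using n by (simp add: power2_eq_square algebra_simps)
    finally show ?thesis using n by simp
  qed
  have frac: "1 / (1 - ?x) \<le> 1 + 2 * ?x"
  proof -
    have "1 \<le> (1 + 2 * t) * (1 - t)" if "0 \<le> t" "t \<le> 1/2" for t :: real
    proof -
      have "0 \<le> t * (1 - 2 * t)" using that by (intro mult_nonneg_nonneg) auto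
      then show ?thesis by (simp add: algebra_simps)
    qed
    then have "1 \<le> (1 + 2 * ?x) * (1 - ?x)" using x by blast
    then show ?thesis using x(2) by (subst pos_divide_le_eq) auto
  qed
  have g: "0 \<le> ?g" "?g\<^sup>2 \<le> 1" using gw_weight_nonneg[of c r S] gw_weight_le_1[of c r S] by (auto simp: power_le_one)
  have A0: "0 \<le> ?A" using c by (intro sum_nonneg) auto
  have "measure_pmf.expectation ?M (\<lambda>E'. (mean_weight V E r S E' - ?g)\<^sup>2) =
     measure_pmf.expectation ?M (\<lambda>E'. (mean_weight V E r S E')\<^sup>2) - 2 * ?g * measure_pmf.expectation ?M (mean_weight V E r S) + ?g\<^sup>2"
    unfolding power2_diff by (simp add: int algebra_simps)
  also have "\<dots> \<le> (?g\<^sup>2 / (1 - ?x) + ?A / ?n) - 2 * ?g * (?g * (1 - ?y)) + ?g\<^sup>2"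
    using E1 E2 g by (intro add_mono diff_mono mult_left_mono) auto
  also have "?g\<^sup>2 / (1 - ?x) \<le> ?g\<^sup>2 * (1 + 2 * ?x)"
    using mult_left_mono[OF frac, of "?g\<^sup>2"] by simp
  also have "?A / ?n \<le> ?A / real d" using A0 n d by (intro divide_left_mono) auto
  also have "?g\<^sup>2 * (1 + 2 * ?x) + ?A / real d - 2 * ?g * (?g * (1 - ?y)) + ?g\<^sup>2 = ?g\<^sup>2 * (2 * ?x + 2 * ?y) + ?A / real d"
    by (simp add: algebra_simps power2_eq_square)
  \<comment> \<open>The factor \<open>m\<^sup>2 \<ge> 1\<close> is inserted to merge all errors into
    one multiple of \<open>m\<^sup>2 / d\<close>.\<close>
  also have "\<dots> \<le> 1 * (2 * ?x + 2 * ?y) + ?A / real d * (real m)\<^sup>2"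
  proof (rule add_mono)
    show "?g\<^sup>2 * (2 * ?x + 2 * ?y) \<le> 1 * (2 * ?x + 2 * ?y)"
      using g x y by (intro mult_right_mono) auto
    have "0 \<le> ?A / real d" using A0 d by simp
    from mult_left_mono[OF m2(2) this] show "?A / real d \<le> ?A / real d * (real m)\<^sup>2" by simp
  qed
  also have "\<dots> = (2 + 16 * c + 4 * c\<^sup>2 + ?A) * (real m)\<^sup>2 / real d"
    by (simp add: add_divide_distrib algebra_simps)
  finally show ?thesis by simp
qed

text \<open>Cauchy--Schwarz in the form that the variance of \<open>\<bar>f\<bar>\<close> is
  nonnegative.\<close>

lemma expectation_abs_le_sqrt:
  fixes f :: "'a \<Rightarrow> real"
  assumes "finite (set_pmf p)"
  shows "measure_pmf.expectation p (\<lambda>x. \<bar>f x\<bar>) \<le> sqrt (measure_pmf.expectation p (\<lambda>x. (f x)\<^sup>2))"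
proof (rule real_le_rsqrt)
  have int: "integrable p g" for g :: "'a \<Rightarrow> real" by (rule integrable_measure_pmf_finite[OF assms])
  have "0 \<le> measure_pmf.variance p (\<lambda>x. \<bar>f x\<bar>)" by (rule measure_pmf.variance_positive)
  also have "\<dots> = measure_pmf.expectation p (\<lambda>x. \<bar>f x\<bar>\<^sup>2) - (measure_pmf.expectation p (\<lambda>x. \<bar>f x\<bar>))\<^sup>2"
    by (rule measure_pmf.variance_eq[OF int int])
  finally show "(measure_pmf.expectation p (\<lambda>x. \<bar>f x\<bar>))\<^sup>2 \<le> measure_pmf.expectation p (\<lambda>x. (f x)\<^sup>2)" by simp
qed

definition tree_error :: "real \<Rightarrow> 'v set \<Rightarrow> 'v set set \<Rightarrow> nat \<Rightarrow> nat \<Rightarrow> 'v set set \<Rightarrow> real" where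
  "tree_error c V E r k E' = (\<Sum>S\<in>plane_trees r k. \<bar>mean_weight V E r S E' - gw_weight c r S\<bar>)"

text \<open>Markov for the sum over all trees. The exponent \<open>2 * (1 + k) ^ r\<close> combines
  the number of trees with their size, for which the same bound is generous but convenient.\<close>

lemma prob_tree_error_ge:
  assumes G: "simple_graph V E" "regular d V E" "V \<noteq> {}"
    and c: "0 < c" and t: "0 < t"
    and small: "(2 + 16 * c + 4 * c\<^sup>2) * (real ((1 + k) ^ r))\<^sup>2 \<le> real d"
  shows "measure_pmf.prob (random_subgraph E (c / real d)) {E'. t \<le> tree_error c V E r k E'} \<le>
    sqrt (2 + 16 * c + 4 * c\<^sup>2 + (\<Sum>i\<le>2 * r. c ^ i)) * real (1 + k) ^ (2 * (1 + k) ^ r) / (t * sqrt (real d))"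
proof -
  let ?M = "random_subgraph E (c / real d)"
  let ?K = "2 + 16 * c + 4 * c\<^sup>2 + (\<Sum>i\<le>2 * r. c ^ i)"
  let ?m = "real ((1 + k) ^ r)"
  have finM: "finite (set_pmf ?M)"
    by (intro finite_set_random_subgraph simple_graphD(6)[OF G(1)])
  have int: "integrable ?M F" for F :: "'a set set \<Rightarrow> real"
    by (rule integrable_measure_pmf_finite[OF finM])
  have K: "0 \<le> ?K" using c by (auto intro!: add_nonneg_nonneg sum_nonneg)
  have one: "measure_pmf.expectation ?M (\<lambda>E'. \<bar>mean_weight V E r S E' - gw_weight c r S\<bar>) \<le> sqrt ?K * ?m / sqrt (real d)"
    if S: "S \<in> plane_trees r k" for S
  proof -
    have "measure_pmf.expectation ?M (\<lambda>E'. \<bar>mean_weight V E r S E' - gw_weight c r S\<bar>) \<le>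
        sqrt (measure_pmf.expectation ?M (\<lambda>E'. (mean_weight V E r S E' - gw_weight c r S)\<^sup>2))"
      by (rule expectation_abs_le_sqrt[OF finM])
    also have "\<dots> \<le> sqrt (?K * ?m\<^sup>2 / real d)"
      using S card_le_plane_trees[OF S]
      by (intro real_sqrt_le_mono second_moment_mean_weight[OF G _ c _ small]) (auto simp: plane_trees_def)
    also have "\<dots> = sqrt ?K * ?m / sqrt (real d)"
      by (simp only: real_sqrt_divide real_sqrt_mult real_sqrt_abs abs_of_nat)
    finally show ?thesis .
  qed
  have "measure_pmf.prob ?M {E'. t \<le> tree_error c V E r k E'} \<le> measure_pmf.expectation ?M (tree_error c V E r k) / t"
  proof -
    have "0 \<le> tree_error c V E r k E'" for E' by (simp add: tree_error_def sum_nonneg)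
    then show ?thesis
      using integral_Markov_inequality_measure[OF int, of UNIV "tree_error c V E r k" t] t by simp
  qed
  also have "measure_pmf.expectation ?M (tree_error c V E r k) =
      (\<Sum>S\<in>plane_trees r k. measure_pmf.expectation ?M (\<lambda>E'. \<bar>mean_weight V E r S E' - gw_weight c r S\<bar>))"
    unfolding tree_error_def by (simp add: Bochner_Integration.integral_sum int)
  also have "\<dots> \<le> (\<Sum>S\<in>plane_trees r k. sqrt ?K * ?m / sqrt (real d))" by (rule sum_mono[OF one])
  also have "\<dots> = real (card (plane_trees r k)) * (sqrt ?K * ?m / sqrt (real d))" by simp
  also have "\<dots> \<le> real ((1 + k) ^ ((1 + k) ^ r)) * (sqrt ?K * real ((1 + k) ^ ((1 + k) ^ r)) / sqrt (real d))"
  proof (intro mult_mono divide_right_mono mult_left_mono)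
    show "real (card (plane_trees r k)) \<le> real ((1 + k) ^ ((1 + k) ^ r))"
      using card_plane_trees[of r k] by (simp only: of_nat_le_iff)
    \<comment> \<open>This compares the exponents, for \<open>1 \<le> k\<close>, by way of
      \<open>r \<le> 2 ^ r\<close>; for \<open>k = 0\<close> both powers are 1.\<close>
    have "r \<le> (1 + k) ^ r" if "1 \<le> k"
      using that by (metis add_leE le_trans less_exp less_imp_le nat_1_add_1 power_mono add_le_mono order.refl zero_le)
    then have "(1 + k) ^ r \<le> (1 + k) ^ ((1 + k) ^ r)"
      by (cases "k = 0") (auto intro: power_increasing)
    then show "?m \<le> real ((1 + k) ^ ((1 + k) ^ r))" by (simp only: of_nat_le_iff)
  qed (use K in auto)
  also have "\<dots> = sqrt ?K * real (1 + k) ^ (2 * (1 + k) ^ r) / sqrt (real d)"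
    by (simp add: mult_2 power_add)
  finally show ?thesis using t by (simp add: divide_right_mono mult.commute)
qed

section \<open>Total variation distance\<close>

lemma rg_isoE:
  assumes "rg_iso (V1, E1, o1) (V2, E2, o2)"
  obtains f where "bij_betw f V1 V2" "f o1 = o2"
    "\<And>x y. x \<in> V1 \<Longrightarrow> y \<in> V1 \<Longrightarrow> {x, y} \<in> E1 \<longleftrightarrow> {f x, f y} \<in> E2"
  using assms unfolding rg_iso_def prod.case by metis

lemma rg_isoI:
  assumes "bij_betw f V1 V2" "f o1 = o2"
    "\<And>x y. x \<in> V1 \<Longrightarrow> y \<in> V1 \<Longrightarrow> {x, y} \<in> E1 \<longleftrightarrow> {f x, f y} \<in> E2"
  shows "rg_iso (V1, E1, o1) (V2, E2, o2)"
  using assms unfolding rg_iso_def prod.case by metis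

lemma rg_iso_refl: "rg_iso G G"
  by (cases G) (auto intro!: rg_isoI[of id])

text \<open>The inverse is controlled only on \<open>V1\<close>, so the root has to lie there for it
  to be mapped back. The two carrier types may differ, as they do for a ball and a representative of
  its class.\<close>

lemma rg_iso_sym:
  assumes "rg_iso (V1, E1, o1) H" "o1 \<in> V1"
  shows "rg_iso H (V1, E1, o1)"
proof -
  obtain V2 E2 o2 where H: "H = (V2, E2, o2)" by (cases H) auto
  from assms(1)[unfolded H] obtain f where f: "bij_betw f V1 V2" "f o1 = o2"
    "\<And>x y. x \<in> V1 \<Longrightarrow> y \<in> V1 \<Longrightarrow> {x, y} \<in> E1 \<longleftrightarrow> {f x, f y} \<in> E2" by (rule rg_isoE) blast
  let ?g = "inv_into V1 f"
  have inv: "?g x \<in> V1" "f (?g x) = x" if "x \<in> V2" for x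
    using f(1) that by (auto simp: bij_betw_def intro: inv_into_into f_inv_into_f)
  show ?thesis unfolding H
  proof (rule rg_isoI)
    show "bij_betw ?g V2 V1" using f(1) by (rule bij_betw_inv_into)
    show "?g o2 = o1" using f(1,2) assms(2) by (metis bij_betw_inv_into_left)
    show "{x, y} \<in> E2 \<longleftrightarrow> {?g x, ?g y} \<in> E1" if "x \<in> V2" "y \<in> V2" for x y
      using f(3)[OF inv(1)[OF that(1)] inv(1)[OF that(2)]] inv(2)[OF that(1)] inv(2)[OF that(2)] by simp
  qed
qed

lemma rg_iso_trans:
  assumes "rg_iso G H" "rg_iso H K"
  shows "rg_iso G K"
proof -
  obtain V1 E1 o1 V2 E2 o2 V3 E3 o3 where
    eq: "G = (V1, E1, o1)" "H = (V2, E2, o2)" "K = (V3, E3, o3)" by (metis prod_cases3)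
  from assms(1)[unfolded eq] obtain f where f: "bij_betw f V1 V2" "f o1 = o2"
    "\<And>x y. x \<in> V1 \<Longrightarrow> y \<in> V1 \<Longrightarrow> {x, y} \<in> E1 \<longleftrightarrow> {f x, f y} \<in> E2" by (rule rg_isoE) blast
  from assms(2)[unfolded eq] obtain g where g: "bij_betw g V2 V3" "g o2 = o3"
    "\<And>x y. x \<in> V2 \<Longrightarrow> y \<in> V2 \<Longrightarrow> {x, y} \<in> E2 \<longleftrightarrow> {g x, g y} \<in> E3" by (rule rg_isoE) blast
  have "f x \<in> V2" if "x \<in> V1" for x using f(1) that by (auto simp: bij_betw_def)
  then show ?thesis unfolding eq
    using f g by (intro rg_isoI[of "g \<circ> f"] bij_betw_trans) auto
qed

lemma equiv_rg_iso:
  "equiv finite_rgraphs {(G, H). G \<in> finite_rgraphs \<and> H \<in> finite_rgraphs \<and> rg_iso G H}"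
proof (rule equivI)
  show "sym {(G, H). G \<in> finite_rgraphs \<and> H \<in> finite_rgraphs \<and> rg_iso G H}"
  proof (rule symI)
    fix G H assume "(G, H) \<in> {(G, H). G \<in> finite_rgraphs \<and> H \<in> finite_rgraphs \<and> rg_iso G H}"
    then have GH: "G \<in> finite_rgraphs" "H \<in> finite_rgraphs" "rg_iso G H" by auto
    obtain V1 E1 o1 where G: "G = (V1, E1, o1)" by (cases G) auto
    then have "o1 \<in> V1" using GH(1) by (simp add: finite_rgraphs_def)
    then have "rg_iso H G" unfolding G by (rule rg_iso_sym[OF GH(3)[unfolded G]])
    then show "(H, G) \<in> {(G, H). G \<in> finite_rgraphs \<and> H \<in> finite_rgraphs \<and> rg_iso G H}" using GH by simp
  qed
  show "trans {(G, H). G \<in> finite_rgraphs \<and> H \<in> finite_rgraphs \<and> rg_iso G H}"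
    by (rule transI) (use rg_iso_trans in blast)
qed (auto simp: refl_on_def rg_iso_refl)

lemma iso_classes_eq:
  assumes "C \<in> iso_classes" "C' \<in> iso_classes" "H \<in> C" "H' \<in> C'" "rg_iso H H'"
  shows "C = C'"
proof -
  have "H \<in> finite_rgraphs" "H' \<in> finite_rgraphs"
    using assms(1-4) in_quotient_imp_subset[OF equiv_rg_iso] unfolding iso_classes_def by blast+
  then show ?thesis
    using assms quotient_eqI[OF equiv_rg_iso] unfolding iso_classes_def by blast
qed

lemma tree_of_in_finite_rgraphs:
  assumes "plane_tree r S"
  shows "tree_of S \<in> finite_rgraphs"
proof -
  have "\<exists>x y. x \<noteq> y \<and> x \<in> S \<and> y \<in> S \<and> e = {x, y}" if "e \<in> {{p, p @ [i]} |p i. p @ [i] \<in> S}" for e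
  proof -
    from that obtain p i where p: "e = {p, p @ [i]}" "p @ [i] \<in> S" by blast
    have "p \<in> S" by (rule plane_treeD(3)[OF assms p(2)])
    then show ?thesis using p by (intro exI[of _ p] exI[of _ "p @ [i]"]) simp
  qed
  then have "simple_graph S {{p, p @ [i]} |p i. p @ [i] \<in> S}"
    unfolding simple_graph_def using plane_treeD(1)[OF assms] by blast
  then show ?thesis
    unfolding finite_rgraphs_def tree_of_def using plane_treeD(2)[OF assms] by simp
qed

lemma tree_of_in_iso_class:
  assumes "plane_tree r S"
  obtains C where "C \<in> iso_classes" "tree_of S \<in> C"
  using quotientI[OF tree_of_in_finite_rgraphs[OF assms]]
    equiv_class_self[OF equiv_rg_iso tree_of_in_finite_rgraphs[OF assms]] that
  unfolding iso_classes_def by blast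

text \<open>A vertex with a ball map for some tree of the class \<open>C\<close> has its ball in
  \<open>C\<close>, and its weights sum to at most 1; all other vertices have weight 0 on these
  trees.\<close>

lemma sum_mean_weight_le_emp_measure:
  assumes G: "simple_graph V E" and E': "E' \<subseteq> E"
  shows "(\<Sum>S\<in>{S \<in> plane_trees r k. tree_of S \<in> C}. mean_weight V E r S E') \<le> emp_measure V E' r C"
proof -
  let ?T = "{S \<in> plane_trees r k. tree_of S \<in> C}"
  let ?A = "{v \<in> V. \<exists>H\<in>C. rg_iso (ball V E' r v) H}"
  have finT: "finite ?T" using finite_plane_trees[of r k] by simp
  have finV: "finite V" by (rule simple_graphD[OF G])
  have tr: "plane_tree r S" if "S \<in> ?T" for S using that by (simp add: plane_trees_def)
  have "(\<Sum>S\<in>?T. ball_weight E r S E' v) \<le> (if v \<in> ?A then 1 else 0)" if v: "v \<in> V" for v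
  proof (cases "v \<in> ?A")
    case True
    then show ?thesis
      using sum_ball_maps_le_1[OF G v E' finT tr] by (simp only: ball_weight_def if_True)
  next
    case False
    have "ball_weight E r S E' v = 0" if S: "S \<in> ?T" for S
    proof -
      have "ball_maps E r v S E' = {}"
      proof (rule ccontr)
        assume "ball_maps E r v S E' \<noteq> {}"
        then obtain f where "f \<in> ball_maps E r v S E'" by auto
        from ball_map_iso[OF tr[OF S] this E' G v] show False using False S v by blast
      qed
      then show ?thesis by (simp add: ball_weight_def)
    qed
    then show ?thesis by simp
  qed
  then have "(\<Sum>v\<in>V. \<Sum>S\<in>?T. ball_weight E r S E' v) \<le> (\<Sum>v\<in>V. if v \<in> ?A then 1 else 0)"
    by (rule sum_mono)
  also have "\<dots> = real (card ?A)"
  proof -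
    have "V \<inter> ?A = ?A" by auto
    then show ?thesis using sum.inter_restrict[OF finV, of "\<lambda>_. 1 :: real" ?A] by simp
  qed
  finally have "(\<Sum>S\<in>?T. \<Sum>v\<in>V. ball_weight E r S E' v) \<le> real (card ?A)"
    by (subst sum.swap)
  then show ?thesis
    unfolding mean_weight_def emp_measure_def sum_divide_distrib[symmetric] by (rule divide_right_mono) simp
qed

lemma prob_gw_ball_le:
  "measure_pmf.prob (gw_ball c r) C \<le> (\<Sum>S\<in>{S \<in> plane_trees r k. tree_of S \<in> C}. gw_weight c r S)
     + measure_pmf.prob (gw_verts c r) ({S. tree_of S \<in> C} - plane_trees r k)"
proof -
  let ?T = "{S \<in> plane_trees r k. tree_of S \<in> C}"
  have fin: "finite ?T" using finite_plane_trees[of r k] by simp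
  have "measure_pmf.prob (gw_ball c r) C = measure_pmf.prob (gw_verts c r) (?T \<union> ({S. tree_of S \<in> C} - plane_trees r k))"
    unfolding gw_ball_def measure_map_pmf by (intro arg_cong[where f="measure_pmf.prob _"]) auto
  also have "\<dots> = measure_pmf.prob (gw_verts c r) ?T + measure_pmf.prob (gw_verts c r) ({S. tree_of S \<in> C} - plane_trees r k)"
    by (rule measure_pmf.finite_measure_Union) auto
  also have "measure_pmf.prob (gw_verts c r) ?T = (\<Sum>S\<in>?T. pmf (gw_verts c r) S)"
    by (rule measure_measure_pmf_finite[OF fin])
  also have "\<dots> \<le> (\<Sum>S\<in>?T. gw_weight c r S)"
    by (intro sum_mono pmf_gw_verts_le) (simp add: plane_trees_def)
  finally show ?thesis by simp
qed

text \<open>Writing \<open>\<bar>a - b\<bar>\<close> as twice the positive part of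
  \<open>b - a\<close> plus \<open>a - b\<close> leaves only deficits to be estimated, and those are
  what the one-sided weight bound controls. They sum to at most \<open>tree_error\<close> plus one
  tail, which enters twice; the third tail is the gap between \<open>\<Sum> a \<le> 1\<close> and
  \<open>\<Sum> b \<ge> 1 - tail\<close>.\<close>

lemma sum_abs_emp_measure_diff_le:
  assumes G: "simple_graph V E" "V \<noteq> {}" and E': "E' \<subseteq> E" and F: "finite F" "F \<subseteq> iso_classes"
  shows "(\<Sum>C\<in>F. \<bar>emp_measure V E' r C - measure_pmf.prob (gw_ball c r) C\<bar>) \<le>
    2 * tree_error c V E r k E' + 3 * measure_pmf.prob (gw_verts c r) (- plane_trees r k)"
proof -
  let ?T = "plane_trees r k"
  let ?P = "measure_pmf.prob (gw_verts c r)"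
  let ?a = "emp_measure V E' r" and ?b = "measure_pmf.prob (gw_ball c r)"
  let ?e = "\<lambda>S. \<bar>mean_weight V E r S E' - gw_weight c r S\<bar>"
  define cl where "cl S = (SOME C. C \<in> iso_classes \<and> tree_of S \<in> C)" for S
  have cl: "cl S \<in> iso_classes" "tree_of S \<in> cl S" if "S \<in> ?T" for S
  proof -
    have "\<exists>C. C \<in> iso_classes \<and> tree_of S \<in> C"
      using tree_of_in_iso_class[of r S] that by (metis (lifting) mem_Collect_eq plane_trees_def)
    from someI_ex[OF this] show "cl S \<in> iso_classes" "tree_of S \<in> cl S" by (auto simp: cl_def)
  qed
  \<comment> \<open>The classes of all truncated trees are added, since otherwise the Galton--Watson
    mass on the finite family need not be close to 1.\<close>
  define F' where "F' = F \<union> cl ` ?T"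
  have F': "finite F'" "F' \<subseteq> iso_classes" using F cl finite_plane_trees by (auto simp: F'_def)
  have finV: "finite V" by (rule simple_graphD[OF G(1)])
  have disj: "C = C'" if "C \<in> F'" "C' \<in> F'" "H \<in> C" "H \<in> C'" for C C' H
    using iso_classes_eq[of C C' H H] that F'(2) rg_iso_refl by blast
  have one: "\<bar>?a C - ?b C\<bar> \<le> 2 * ((\<Sum>S\<in>{S \<in> ?T. tree_of S \<in> C}. ?e S) + ?P ({S. tree_of S \<in> C} - ?T)) + ?a C - ?b C" for C
  proof -
    have "?b C - ?a C \<le> (\<Sum>S\<in>{S \<in> ?T. tree_of S \<in> C}. gw_weight c r S - mean_weight V E r S E') + ?P ({S. tree_of S \<in> C} - ?T)"
      using prob_gw_ball_le[of c r C k] sum_mean_weight_le_emp_measure[OF G(1) E', of r k C]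
      unfolding sum_subtractf by linarith
    also have "(\<Sum>S\<in>{S \<in> ?T. tree_of S \<in> C}. gw_weight c r S - mean_weight V E r S E') \<le> (\<Sum>S\<in>{S \<in> ?T. tree_of S \<in> C}. ?e S)"
      by (rule sum_mono) linarith
    finally have 1: "?b C - ?a C \<le> (\<Sum>S\<in>{S \<in> ?T. tree_of S \<in> C}. ?e S) + ?P ({S. tree_of S \<in> C} - ?T)" by simp
    have "0 \<le> (\<Sum>S\<in>{S \<in> ?T. tree_of S \<in> C}. ?e S)" "0 \<le> ?P ({S. tree_of S \<in> C} - ?T)"
      by (auto intro: sum_nonneg)
    then have 2: "0 \<le> (\<Sum>S\<in>{S \<in> ?T. tree_of S \<in> C}. ?e S) + ?P ({S. tree_of S \<in> C} - ?T)" by (rule add_nonneg_nonneg)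
    have "\<bar>x - y\<bar> \<le> 2 * z + x - y" if "y - x \<le> z" "0 \<le> z" for x y z :: real
      using that by linarith
    from this[OF 1 2] show ?thesis .
  qed
  have err: "(\<Sum>C\<in>F'. \<Sum>S\<in>{S \<in> ?T. tree_of S \<in> C}. ?e S) \<le> tree_error c V E r k E'"
  proof -
    have "(\<Sum>C\<in>F'. \<Sum>S\<in>{S \<in> ?T. tree_of S \<in> C}. ?e S) = (\<Sum>S\<in>(\<Union>C\<in>F'. {S \<in> ?T. tree_of S \<in> C}). ?e S)"
    proof (rule sum.UNION_disjoint[symmetric])
      show "\<forall>C\<in>F'. \<forall>C'\<in>F'. C \<noteq> C' \<longrightarrow> {S \<in> ?T. tree_of S \<in> C} \<inter> {S \<in> ?T. tree_of S \<in> C'} = {}"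
        using disj by blast
    qed (use F'(1) finite_plane_trees[of r k] in auto)
    also have "\<dots> \<le> tree_error c V E r k E'"
      unfolding tree_error_def using finite_plane_trees[of r k] by (intro sum_mono2) auto
    finally show ?thesis .
  qed
  have tail: "(\<Sum>C\<in>F'. ?P ({S. tree_of S \<in> C} - ?T)) \<le> ?P (- ?T)"
  proof -
    have "(\<Sum>C\<in>F'. ?P ({S. tree_of S \<in> C} - ?T)) = ?P (\<Union>C\<in>F'. {S. tree_of S \<in> C} - ?T)"
      using F'(1) disj 
      by (intro measure_pmf.finite_measure_finite_Union[symmetric]) (simp, simp, unfold disjoint_family_on_def, blast)
    also have "\<dots> \<le> ?P (- ?T)" by (intro measure_pmf.finite_measure_mono) auto
    finally show ?thesis .
  qed
  have suma: "(\<Sum>C\<in>F'. ?a C) \<le> 1"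
  proof -
    let ?A = "\<lambda>C. {v \<in> V. \<exists>H\<in>C. rg_iso (ball V E' r v) H}"
    have "C = C'" if C: "C \<in> F'" "C' \<in> F'" "v \<in> ?A C" "v \<in> ?A C'" for C C' v
    proof -
      from C(3,4) obtain H H' where H: "H \<in> C" "H' \<in> C'" "rg_iso (ball V E' r v) H" "rg_iso (ball V E' r v) H'" "v \<in> V" by auto
      \<comment> \<open>The ball has vertices of type \<open>'v\<close> and lies in no class itself,
        so the two representatives are compared through it; symmetry needs its root to be one of its
        vertices.\<close>
      have "dist_le E' r v v" using dist_le_mono[of E' 0 v v r] by simp
      then have "rg_iso H (ball V E' r v)"
        using H(3,5) unfolding ball_def Let_def by (intro rg_iso_sym) auto
      then show ?thesis using iso_classes_eq[of C C' H H'] rg_iso_trans H C F'(2) by blast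
    qed
    then have "(\<Sum>C\<in>F'. card (?A C)) = card (\<Union>C\<in>F'. ?A C)"
      using F'(1) finV by (intro card_UN_disjoint[symmetric] ballI impI) (simp, simp, blast)
    also have "\<dots> \<le> card V" using finV by (intro card_mono) auto
    finally have "real (\<Sum>C\<in>F'. card (?A C)) \<le> real (card V)" by (simp only: of_nat_le_iff)
    then show ?thesis
      unfolding emp_measure_def sum_divide_distrib[symmetric] using finV G(2) by (simp add: divide_le_eq_1 card_gt_0_iff)
  qed
  have sumb: "1 - ?P (- ?T) \<le> (\<Sum>C\<in>F'. ?b C)"
  proof -
    have "1 - ?P (- ?T) = ?P ?T" using measure_pmf.prob_compl[of ?T "gw_verts c r"] by (simp add: Compl_eq_Diff_UNIV)
    also have "\<dots> \<le> ?P (\<Union>C\<in>F'. {S. tree_of S \<in> C})"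
      using cl by (intro measure_pmf.finite_measure_mono) (auto simp: F'_def)
    also have "\<dots> \<le> (\<Sum>C\<in>F'. ?P {S. tree_of S \<in> C})"
      using F'(1) by (intro measure_pmf.finite_measure_subadditive_finite) auto
    also have "\<dots> = (\<Sum>C\<in>F'. ?b C)" by (simp add: gw_ball_def measure_map_pmf vimage_def)
    finally show ?thesis .
  qed
  have "(\<Sum>C\<in>F. \<bar>?a C - ?b C\<bar>) \<le> (\<Sum>C\<in>F'. \<bar>?a C - ?b C\<bar>)"
    using F'(1) by (intro sum_mono2) (auto simp: F'_def)
  also have "\<dots> \<le> (\<Sum>C\<in>F'. 2 * ((\<Sum>S\<in>{S \<in> ?T. tree_of S \<in> C}. ?e S) + ?P ({S. tree_of S \<in> C} - ?T)) + ?a C - ?b C)"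
    by (rule sum_mono[OF one])
  also have "\<dots> = 2 * ((\<Sum>C\<in>F'. \<Sum>S\<in>{S \<in> ?T. tree_of S \<in> C}. ?e S) + (\<Sum>C\<in>F'. ?P ({S. tree_of S \<in> C} - ?T))) + (\<Sum>C\<in>F'. ?a C) - (\<Sum>C\<in>F'. ?b C)"
    by (simp only: sum_subtractf sum.distrib sum_distrib_left[symmetric])
  also have "\<dots> \<le> 2 * tree_error c V E r k E' + 3 * ?P (- ?T)"
  proof -
    have "2 * (x + y) + a - b \<le> 2 * X + 3 * Y" if "x \<le> X" "y \<le> Y" "a \<le> 1" "1 - Y \<le> b" for x y a b X Y :: real
      using that by simp
    from this[OF err tail suma sumb] show ?thesis .
  qed
  finally show ?thesis .
qed

text \<open>There are infinitely many classes. A bound on the finite partial sums that is uniform in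
  the family yields both summability and the bound on \<open>infsum\<close>.\<close>

lemma dTV_le_tree_error:
  assumes G: "simple_graph V E" "V \<noteq> {}" and E': "E' \<subseteq> E"
  shows "dTV (emp_measure V E' r) (\<lambda>C. measure_pmf.prob (gw_ball c r) C) \<le>
    tree_error c V E r k E' + 3 / 2 * measure_pmf.prob (gw_verts c r) (- plane_trees r k)"
proof -
  let ?f = "\<lambda>C. \<bar>emp_measure V E' r C - measure_pmf.prob (gw_ball c r) C\<bar>"
  let ?B = "2 * tree_error c V E r k E' + 3 * measure_pmf.prob (gw_verts c r) (- plane_trees r k)"
  have "?f summable_on iso_classes"
    by (rule nonneg_bounded_partial_sums_imp_summable_on[where C="?B"])
       (auto intro!: eventually_finite_subsets_at_top_weakI sum_abs_emp_measure_diff_le[OF assms])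
  then have "infsum ?f iso_classes \<le> ?B"
    by (rule infsum_le_finite_sums) (rule sum_abs_emp_measure_diff_le[OF assms])
  then show ?thesis unfolding dTV_def by simp
qed

section \<open>Asymptotics\<close>

lemma prob_random_subgraph_mono:
  assumes "\<And>E'. E' \<subseteq> E \<Longrightarrow> P E' \<Longrightarrow> Q E'"
  shows "measure_pmf.prob (random_subgraph E p) {E'. P E'} \<le> measure_pmf.prob (random_subgraph E p) {E'. Q E'}"
proof (rule measure_pmf.finite_measure_mono_AE)
  show "AE E' in random_subgraph E p. E' \<in> {E'. P E'} \<longrightarrow> E' \<in> {E'. Q E'}"
    unfolding AE_measure_pmf_iff using assms set_random_subgraph[of _ E p] by blast
qed simp

lemma gw_verts_tail_le:
  assumes "c > 0"
  shows "measure_pmf.prob (gw_verts c r) (- plane_trees r k) \<le>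
    exp ((exp 1 - 1) * c) * exp (- real k) * real (1 + k) ^ r"
  by (rule order_trans[OF gw_verts_tail mult_right_mono[OF poisson_tail[OF assms]]]) simp

text \<open>The threshold is split evenly: the tail term \<open>3 / 2 * P\<close> takes at most
  \<open>t / 2\<close>, so \<open>tree_error\<close> must make up the other half.\<close>

lemma prob_dTV_ge_le:
  assumes G: "simple_graph V E" "regular d V E" "V \<noteq> {}" and c: "0 < c" and t: "0 < t"
    and small: "(2 + 16 * c + 4 * c\<^sup>2) * (real ((1 + k) ^ r))\<^sup>2 \<le> real d"
    and tail: "3 * measure_pmf.prob (gw_verts c r) (- plane_trees r k) \<le> t"
  shows "measure_pmf.prob (random_subgraph E (c / real d))
      {E'. dTV (emp_measure V E' r) (\<lambda>C. measure_pmf.prob (gw_ball c r) C) \<ge> t} \<le>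
    sqrt (2 + 16 * c + 4 * c\<^sup>2 + (\<Sum>i\<le>2 * r. c ^ i)) * real (1 + k) ^ (2 * (1 + k) ^ r) / (t / 2 * sqrt (real d))"
proof -
  have "measure_pmf.prob (random_subgraph E (c / real d))
      {E'. dTV (emp_measure V E' r) (\<lambda>C. measure_pmf.prob (gw_ball c r) C) \<ge> t} \<le>
    measure_pmf.prob (random_subgraph E (c / real d)) {E'. t / 2 \<le> tree_error c V E r k E'}"
  proof (rule prob_random_subgraph_mono)
    fix E' assume "E' \<subseteq> E" "t \<le> dTV (emp_measure V E' r) (\<lambda>C. measure_pmf.prob (gw_ball c r) C)"
    then show "t / 2 \<le> tree_error c V E r k E'"
      using dTV_le_tree_error[OF G(1,3), of E' r c k] tail by simp
  qed
  also have "\<dots> \<le> sqrt (2 + 16 * c + 4 * c\<^sup>2 + (\<Sum>i\<le>2 * r. c ^ i)) * real (1 + k) ^ (2 * (1 + k) ^ r) / (t / 2 * sqrt (real d))"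
    using t by (intro prob_tree_error_ge[OF G c _ small]) simp
  finally show ?thesis .
qed

text \<open>The partial sum over the single class \<open>C\<close> is used. It lacks the factor 1/2
  of the total variation distance, hence \<open>6\<close> and \<open>t / 4\<close> in place of
  \<open>3\<close> and \<open>t / 2\<close>.\<close>

lemma prob_emp_measure_diff_ge_le:
  assumes G: "simple_graph V E" "regular d V E" "V \<noteq> {}" and c: "0 < c" and t: "0 < t"
    and C: "C \<in> iso_classes"
    and small: "(2 + 16 * c + 4 * c\<^sup>2) * (real ((1 + k) ^ r))\<^sup>2 \<le> real d"
    and tail: "6 * measure_pmf.prob (gw_verts c r) (- plane_trees r k) \<le> t"
  shows "measure_pmf.prob (random_subgraph E (c / real d))
      {E'. \<bar>emp_measure V E' r C - measure_pmf.prob (gw_ball c r) C\<bar> \<ge> t} \<le>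
    sqrt (2 + 16 * c + 4 * c\<^sup>2 + (\<Sum>i\<le>2 * r. c ^ i)) * real (1 + k) ^ (2 * (1 + k) ^ r) / (t / 4 * sqrt (real d))"
proof -
  have "measure_pmf.prob (random_subgraph E (c / real d))
      {E'. \<bar>emp_measure V E' r C - measure_pmf.prob (gw_ball c r) C\<bar> \<ge> t} \<le>
    measure_pmf.prob (random_subgraph E (c / real d)) {E'. t / 4 \<le> tree_error c V E r k E'}"
  proof (rule prob_random_subgraph_mono)
    fix E' assume "E' \<subseteq> E" "t \<le> \<bar>emp_measure V E' r C - measure_pmf.prob (gw_ball c r) C\<bar>"
    then show "t / 4 \<le> tree_error c V E r k E'"
      using sum_abs_emp_measure_diff_le[OF G(1,3), of E' "{C}" r c k] C tail by simp
  qed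
  also have "\<dots> \<le> sqrt (2 + 16 * c + 4 * c\<^sup>2 + (\<Sum>i\<le>2 * r. c ^ i)) * real (1 + k) ^ (2 * (1 + k) ^ r) / (t / 4 * sqrt (real d))"
    using t by (intro prob_tree_error_ge[OF G c _ small]) simp
  finally show ?thesis .
qed

lemma power_mult_exp_tendsto_0: "((\<lambda>x::real. (1 + x) ^ r * exp (- (a * x))) \<longlongrightarrow> 0) at_top" if "a > 0" for r :: nat
  using that by real_asymp

text \<open>The margin between \<open>exp (- x)\<close> and \<open>exp (- x / 4)\<close> is
  \<open>exp (- 3/4 * x)\<close>, which absorbs any polynomial factor.\<close>

lemma eventually_tail_small:
  fixes A :: real
  shows "eventually (\<lambda>x::real. A * (1 + x) ^ r * exp (- x) \<le> exp (- (1/4) * x)) at_top"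
proof -
  have "((\<lambda>x::real. A * ((1 + x) ^ r * exp (- (3/4 * x)))) \<longlongrightarrow> A * 0) at_top"
    by (intro tendsto_mult tendsto_const power_mult_exp_tendsto_0) simp
  then have "((\<lambda>x::real. A * ((1 + x) ^ r * exp (- (3/4 * x)))) \<longlongrightarrow> 0) at_top" by simp
  then have "eventually (\<lambda>x::real. A * ((1 + x) ^ r * exp (- (3/4 * x))) < 1) at_top"
    by (rule order_tendstoD) simp
  then show ?thesis
  proof eventually_elim
    case (elim x)
    have "A * (1 + x) ^ r * exp (- x) = A * ((1 + x) ^ r * exp (- (3/4 * x))) * exp (- (1/4) * x)"
      by (simp add: mult.assoc flip: exp_add)
    also have "\<dots> \<le> 1 * exp (- (1/4) * x)" using elim by (intro mult_right_mono) auto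
    finally show ?case by simp
  qed
qed

text \<open>The three terms are the logarithms of the tree count with sizes, of the inverse
  threshold, and of \<open>d powr (1/3 - 1/2)\<close> where \<open>ln d = x ^ (2 * r)\<close>. The
  last one wins because \<open>x ^ (2 * r)\<close> exceeds \<open>x ^ r * ln x\<close> by a factor
  \<open>x ^ r / ln x\<close>.\<close>

lemma growth_tendsto_0:
  assumes "r \<ge> 1"
  shows "((\<lambda>x::real. exp (2 * (1 + x) ^ r * ln (1 + x) + x / 4 - x ^ (2 * r) / 6)) \<longlongrightarrow> 0) at_top"
proof (rule Lim_null_comparison)
  define A :: real where "A = 2 ^ Suc r"
  have "A > 0" by (simp add: A_def)
  then have "eventually (\<lambda>x::real. A * ln (1 + x) + 1 / 4 - x / 6 \<le> - 1) at_top" by real_asymp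
  then show "eventually (\<lambda>x::real. norm (exp (2 * (1 + x) ^ r * ln (1 + x) + x / 4 - x ^ (2 * r) / 6)) \<le> exp (- x)) at_top"
    using eventually_ge_at_top[of 1]
  proof eventually_elim
    case (elim x)
    have xr: "x \<le> x ^ r" using elim assms by (intro self_le_power) auto
    have "(1 + x) ^ r \<le> (2 * x) ^ r" using elim by (intro power_mono) auto
    then have "2 * (1 + x) ^ r * ln (1 + x) \<le> A * x ^ r * ln (1 + x)"
      using elim by (intro mult_right_mono) (auto simp: A_def power_mult_distrib)
    moreover have "x / 4 \<le> x ^ r / 4" using xr by simp
    moreover have "x ^ r * x \<le> x ^ (2 * r)"
      using xr elim by (simp add: mult_2 power_add)
    ultimately have "2 * (1 + x) ^ r * ln (1 + x) + x / 4 - x ^ (2 * r) / 6 \<le> x ^ r * (A * ln (1 + x) + 1 / 4 - x / 6)"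
      by (simp add: algebra_simps)
    also have "\<dots> \<le> x ^ r * (- 1)" using elim by (intro mult_left_mono) auto
    also have "\<dots> \<le> - x" using xr by simp
    finally show ?case by simp
  qed
  show "((\<lambda>x::real. exp (- x)) \<longlongrightarrow> 0) at_top" by real_asymp
qed

theorem theorem3p1:
  fixes c :: real and G :: "nat \<Rightarrow> 'v set \<times> 'v set set"
  assumes c_pos: "c > 0"
    and graphs: "\<And>d. simple_graph (fst (G d)) (snd (G d))"
    and reg: "\<And>d. regular d (fst (G d)) (snd (G d))"
    and nonempty: "\<And>d. fst (G d) \<noteq> {}"
  shows "(\<forall>r::nat. r \<ge> 1 \<longrightarrow>
           (\<lambda>d::nat. measure_pmf.prob (random_subgraph (snd (G d)) (c / real d))
              {E'. dTV (emp_measure (fst (G d)) E' r) (\<lambda>C. measure_pmf.prob (gw_ball c r) C)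
                     \<ge> exp (- (1/4) * (ln (real d)) powr (1 / (2 * real r)))})
           \<in> o(\<lambda>d. real d powr (- 1/3)))
       \<and> (\<forall>r::nat. \<forall>C\<in>iso_classes. \<forall>\<epsilon>>0.
           ((\<lambda>d::nat. measure_pmf.prob (random_subgraph (snd (G d)) (c / real d))
              {E'. \<bar>emp_measure (fst (G d)) E' r C - measure_pmf.prob (gw_ball c r) C\<bar> \<ge> \<epsilon>})
            \<longlongrightarrow> 0) at_top)"
proof (intro conjI allI impI ballI)
  fix r :: nat assume r: "r \<ge> 1"
  define x where "x d = ln (real d) powr (1 / (2 * real r))" for d :: nat
  \<comment> \<open>With \<open>ln d = x\<^bsup>2r\<^esup>\<close>, truncating degrees at \<open>x\<close> leaves \<open>exp (x\<^sup>r ln x) = d\<^bsup>o(1)\<^esup>\<close> trees, while the discarded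
    mass \<open>exp (- x)\<close> stays below the threshold \<open>exp (- x/4)\<close>.\<close>
  define k where "k d = nat \<lfloor>x d\<rfloor>" for d
  let ?f = "\<lambda>d::nat. measure_pmf.prob (random_subgraph (snd (G d)) (c / real d))
    {E'. dTV (emp_measure (fst (G d)) E' r) (\<lambda>C. measure_pmf.prob (gw_ball c r) C) \<ge> exp (- (1/4) * x d)}"
  let ?K = "sqrt (2 + 16 * c + 4 * c\<^sup>2 + (\<Sum>i\<le>2 * r. c ^ i))"
  let ?h = "\<lambda>x::real. exp (2 * (1 + x) ^ r * ln (1 + x) + x / 4 - x ^ (2 * r) / 6)"
  let ?L = "2 + 16 * c + 4 * c\<^sup>2"
  let ?A = "3 * (exp ((exp 1 - 1) * c) * exp 1)"
  have K: "0 \<le> ?K" using c_pos by (intro real_sqrt_ge_zero add_nonneg_nonneg sum_nonneg) auto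
  have L: "0 \<le> ?L" using c_pos by simp
  have a: "1 / (2 * real r) > 0" using r by simp
  have "filterlim (\<lambda>d::nat. ln (real d)) at_top at_top" by real_asymp
  moreover have "filterlim (\<lambda>y::real. y powr (1 / (2 * real r))) at_top at_top" using a by real_asymp
  ultimately have xlim: "filterlim x at_top at_top"
    unfolding x_def by (rule filterlim_compose[rotated])
  have bound: "eventually (\<lambda>d. norm (?f d / real d powr (- 1/3)) \<le> 2 * ?K * ?h (x d)) at_top"
  proof -
    \<comment> \<open>This will supply \<open>small\<close>: \<open>(1 + k) ^ (2 * r)\<close> is at
      most \<open>(2 * x) ^ (2 * r) = 4 ^ r * ln d\<close>.\<close>
    have "eventually (\<lambda>d::nat. ?L * (4 ^ r * ln (real d)) \<le> real d) at_top"
    proof -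
      have "\<And>B::real. eventually (\<lambda>d::nat. B * ln (real d) \<le> real d) at_top" by real_asymp
      from this[of "?L * 4 ^ r"] show ?thesis by (simp add: mult.assoc)
    qed
    moreover have "eventually (\<lambda>d. x d \<ge> 1) at_top"
      using xlim by (simp add: filterlim_at_top)
    moreover have "eventually (\<lambda>d. ?A * (1 + x d) ^ r * exp (- x d) \<le> exp (- (1/4) * x d)) at_top"
      by (rule eventually_compose_filterlim[OF eventually_tail_small xlim])
    moreover have "eventually (\<lambda>d::nat. d \<ge> 2) at_top" by (rule eventually_ge_at_top)
    ultimately show ?thesis
    proof eventually_elim
      case (elim d)
      have lnd: "ln (real d) > 0" using elim(4) by simp
      have "x d ^ (2 * r) = ln (real d) powr (1 / (2 * real r) * real (2 * r))"
        unfolding x_def powr_powr[symmetric] using lnd by (subst powr_realpow) auto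
      then have xpow: "x d ^ (2 * r) = ln (real d)" using lnd r by simp
      \<comment> \<open>Rounding down costs a factor \<open>exp 1\<close> in
        \<open>exp (- k) \<le> exp (1 - x)\<close>, which is the \<open>exp 1\<close> inside
        \<open>?A\<close>.\<close>
      have k: "real (k d) \<le> x d" "x d \<le> real (k d) + 1"
        unfolding k_def using elim(2) by linarith+
      have kr: "real ((1 + k d) ^ r) \<le> (1 + x d) ^ r"
        unfolding of_nat_power using k by (intro power_mono) auto
      have "(1 + x d) ^ r \<le> (2 * x d) ^ r" using elim(2) by (intro power_mono) auto
      then have "(real ((1 + k d) ^ r))\<^sup>2 \<le> ((2 * x d) ^ r)\<^sup>2" using kr by (intro power_mono) auto
      also have "\<dots> = 4 ^ r * x d ^ (2 * r)"
        by (simp add: power_mult_distrib power_mult[symmetric] mult.commute[of r 2]) (simp add: power_mult)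
      finally have "(real ((1 + k d) ^ r))\<^sup>2 \<le> 4 ^ r * ln (real d)" unfolding xpow .
      then have small: "?L * (real ((1 + k d) ^ r))\<^sup>2 \<le> real d"
        using mult_left_mono[OF _ L] elim(1) by fastforce
      have tail: "3 * measure_pmf.prob (gw_verts c r) (- plane_trees r (k d)) \<le> exp (- (1/4) * x d)"
      proof -
        have "3 * measure_pmf.prob (gw_verts c r) (- plane_trees r (k d)) \<le>
            3 * (exp ((exp 1 - 1) * c) * exp (- real (k d)) * real (1 + k d) ^ r)"
          using gw_verts_tail_le[OF c_pos] by (intro mult_left_mono) auto
        also have "\<dots> \<le> 3 * (exp ((exp 1 - 1) * c) * exp (1 - x d) * (1 + x d) ^ r)"
          using k kr by (intro mult_left_mono mult_mono) auto
        also have "\<dots> = ?A * (1 + x d) ^ r * exp (- x d)"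
          by (simp add: exp_diff exp_minus field_simps)
        finally show ?thesis using elim(3) by linarith
      qed
      have pow: "real (1 + k d) ^ (2 * (1 + k d) ^ r) \<le> exp (2 * (1 + x d) ^ r * ln (1 + x d))"
      proof -
        have "real (1 + k d) ^ (2 * (1 + k d) ^ r) = exp (real (2 * (1 + k d) ^ r) * ln (real (1 + k d)))"
          by (subst exp_of_nat_mult) simp
        also have "\<dots> \<le> exp (2 * (1 + x d) ^ r * ln (1 + x d))"
        proof (subst exp_le_cancel_iff, rule mult_mono)
          show "real (2 * (1 + k d) ^ r) \<le> 2 * (1 + x d) ^ r" using kr by simp
          show "ln (real (1 + k d)) \<le> ln (1 + x d)" using k by simp
        qed (use elim(2) in auto)
        finally show ?thesis .
      qed
      have d: "real d > 0" using elim(4) by simp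
      \<comment> \<open>The 1/3 comes from the normalisation and the 1/2 from the second moment; the
        difference is the 1/6 in \<open>?h\<close>.\<close>
      have powr: "real d powr (1/3) / sqrt (real d) = exp (- (x d ^ (2 * r) / 6))"
      proof -
        have "real d powr (1/3) / sqrt (real d) = real d powr (1/3 - 1/2)"
          unfolding powr_diff powr_half_sqrt[OF less_imp_le[OF d]] ..
        also have "\<dots> = exp (- (ln (real d) / 6))" using d by (simp add: powr_def)
        finally show ?thesis unfolding xpow .
      qed
      have "?f d \<le> ?K * real (1 + k d) ^ (2 * (1 + k d) ^ r) / (exp (- (1/4) * x d) / 2 * sqrt (real d))"
        by (rule prob_dTV_ge_le[OF graphs reg nonempty c_pos _ small tail]) simp
      also have "\<dots> \<le> ?K * exp (2 * (1 + x d) ^ r * ln (1 + x d)) / (exp (- (1/4) * x d) / 2 * sqrt (real d))"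
        using pow K d by (intro divide_right_mono mult_left_mono) auto
      finally have f: "?f d \<le> ?K * exp (2 * (1 + x d) ^ r * ln (1 + x d)) / (exp (- (1/4) * x d) / 2 * sqrt (real d))" .
      have "norm (?f d / real d powr (- 1/3)) = ?f d * real d powr (1/3)"
        using d by (simp add: powr_minus_divide field_simps flip: powr_add)
      also have "\<dots> \<le> ?K * exp (2 * (1 + x d) ^ r * ln (1 + x d)) / (exp (- (1/4) * x d) / 2 * sqrt (real d)) * real d powr (1/3)"
        using f by (rule mult_right_mono) simp
      also have "\<dots> = 2 * ?K * (exp (2 * (1 + x d) ^ r * ln (1 + x d)) * exp (x d / 4)) * (real d powr (1/3) / sqrt (real d))"
        by (simp add: exp_minus field_simps)
      also have "\<dots> = 2 * ?K * ?h (x d)"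
        unfolding powr diff_conv_add_uminus exp_add by (simp only: mult.assoc)
      finally show ?case .
    qed
  qed
  have "((\<lambda>d. 2 * ?K * ?h (x d)) \<longlongrightarrow> 2 * ?K * 0) at_top"
    by (intro tendsto_mult tendsto_const filterlim_compose[OF growth_tendsto_0[OF r] xlim])
  then have "((\<lambda>d. ?f d / real d powr (- 1/3)) \<longlongrightarrow> 0) at_top"
    by (intro Lim_null_comparison[OF bound]) simp
  moreover have "eventually (\<lambda>d::nat. real d powr (- 1/3) \<noteq> 0) at_top"
    using eventually_gt_at_top[of 0] by eventually_elim simp
  ultimately show "(\<lambda>d::nat. measure_pmf.prob (random_subgraph (snd (G d)) (c / real d))
              {E'. dTV (emp_measure (fst (G d)) E' r) (\<lambda>C. measure_pmf.prob (gw_ball c r) C)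
                     \<ge> exp (- (1/4) * (ln (real d)) powr (1 / (2 * real r)))})
           \<in> o(\<lambda>d. real d powr (- 1/3))"
    unfolding x_def by (rule smalloI_tendsto)
next
  fix r :: nat and C and \<epsilon> :: real assume C: "C \<in> iso_classes" and \<epsilon>: "\<epsilon> > 0"
  let ?f = "\<lambda>d::nat. measure_pmf.prob (random_subgraph (snd (G d)) (c / real d))
              {E'. \<bar>emp_measure (fst (G d)) E' r C - measure_pmf.prob (gw_ball c r) C\<bar> \<ge> \<epsilon>}"
  \<comment> \<open>Since \<open>\<epsilon>\<close> does not depend on \<open>d\<close>, a fixed
    degree bound \<open>k\<close> suffices and the probability is \<open>O(1 / sqrt d)\<close>. This
    direct argument also covers \<open>r = 0\<close>, which the first part excludes.\<close>
  let ?B = "6 * exp ((exp 1 - 1) * c)"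
  have "((\<lambda>k::nat. ?B * ((1 + real k) ^ r * exp (- (1 * real k)))) \<longlongrightarrow> ?B * 0) at_top"
    by (intro tendsto_mult tendsto_const filterlim_compose[OF power_mult_exp_tendsto_0 filterlim_real_sequentially]) simp
  then have "((\<lambda>k::nat. ?B * ((1 + real k) ^ r * exp (- (1 * real k)))) \<longlongrightarrow> 0) at_top" by simp
  from order_tendstoD(2)[OF this \<epsilon>] obtain k :: nat where k: "?B * ((1 + real k) ^ r * exp (- (1 * real k))) < \<epsilon>"
    by (auto simp: eventually_sequentially)
  have tail: "6 * measure_pmf.prob (gw_verts c r) (- plane_trees r k) \<le> \<epsilon>"
    using gw_verts_tail_le[OF c_pos, of r k] k by (simp add: mult_ac)
  define B where "B = sqrt (2 + 16 * c + 4 * c\<^sup>2 + (\<Sum>i\<le>2 * r. c ^ i)) * real (1 + k) ^ (2 * (1 + k) ^ r) / (\<epsilon> / 4)"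
  have "eventually (\<lambda>d::nat. (2 + 16 * c + 4 * c\<^sup>2) * (real ((1 + k) ^ r))\<^sup>2 \<le> real d) at_top"
    using filterlim_real_sequentially unfolding filterlim_at_top by blast
  then have "eventually (\<lambda>d. norm (?f d) \<le> B * (1 / sqrt (real d))) at_top"
  proof eventually_elim
    case (elim d)
    have "?f d \<le> sqrt (2 + 16 * c + 4 * c\<^sup>2 + (\<Sum>i\<le>2 * r. c ^ i)) * real (1 + k) ^ (2 * (1 + k) ^ r) / (\<epsilon> / 4 * sqrt (real d))"
      by (rule prob_emp_measure_diff_ge_le[OF graphs reg nonempty c_pos \<epsilon> C elim tail])
    also have "\<dots> = B * (1 / sqrt (real d))" by (simp add: B_def)
    finally show ?case by simp
  qed
  moreover have "((\<lambda>d::nat. B * (1 / sqrt (real d))) \<longlongrightarrow> 0) at_top" by real_asymp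
  ultimately show "(?f \<longlongrightarrow> 0) at_top" by (rule Lim_null_comparison)
qed

end
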